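(* Let $K$ be a commutative $\mathbb Q$-algebra, $n\ge 1$, and let $P\in K[[X_1,\ldots,X_n]]$ be such that every component of $\nabla P=(D_1P,\ldots,D_nP)$ has only terms of degree $\ge 2$. Let $F=X-\nabla P$ and let $G=(G_1,\ldots,G_n)$ be the formal inverse of $F$. Then $G=X+\nabla Q$, where $$Q=\sum_{T\in\mathbb T}\frac{1}{|\mathrm{Aut}\,T|}\,\mathcal Q_{T,P},\qquad \mathcal Q_{T,P}=\sum_{\ell:E(T)\to\{1,\ldots,n\}}\ \prod_{v\in V(T)}D_{\mathrm{adj}(v)}P .$$
   Context: $X=(X_1,\ldots,X_n)$ and $D_i=\partial/\partial X_i$. A formal map of special type is a system $F=(F_1,\ldots,F_n)$ of power series over $K$ with each $F_i$ of the form $X_i+(\text{terms of degree}\ge 2)$; it has a unique formal inverse, i.e. a formal map $G$ of special type with $F\circ G=G\circ F=X$. $\mathbb T$ denotes the set of isomorphism classes of finite free (unrooted) trees; for a tree $T$, $V(T)$ and $E(T)$ are its sets of vertices and edges and $\mathrm{Aut}\,T$ is its automorphism group. Given a labeling $\ell:E(T)\to\{1,\ldots,n\}$ and $v\in V(T)$, $\mathrm{adj}(v)=\{e_1,\ldots,e_s\}$ is the set of edges adjacent to $v$, and $D_{\mathrm{adj}(v)}=D_{\ell(e_1)}\cdots D_{\ell(e_s)}$ (the identity operator if $s=0$). The infinite sum is understood in the formal (adic) sense. *)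

theory Defs
  imports
    "HOL-Analysis.Infinite_Sum"
    "HOL-Combinatorics.Permutations"
    "HOL-Library.FuncSet"
begin

section \<open>Formal power series in finitely many variables\<close>

text \<open>
  The variables are indexed by a finite type \<open>'n\<close>, and an exponent is a function
  \<open>e :: 'n \<Rightarrow> nat\<close>, so \<open>mps_nth f e\<close> is the coefficient of \<open>\<Prod>i. X i ^ e i\<close> in \<open>f\<close>.
  Order and difference of exponents are pointwise.
\<close>

typedef ('a, 'n) mps = "UNIV :: (('n \<Rightarrow> nat) \<Rightarrow> 'a) set"
  morphisms mps_nth Abs_mps
  by simp

lemma mps_nth_Abs_mps [simp]: "mps_nth (Abs_mps f) = f"
  by (simp add: Abs_mps_inverse)

lemma mps_eq_iff: "f = g \<longleftrightarrow> (\<forall>e. mps_nth f e = mps_nth g e)"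
  by (metis ext mps_nth_inject)

lemma mps_ext: "(\<And>e. mps_nth f e = mps_nth g e) \<Longrightarrow> f = g"
  by (simp add: mps_eq_iff)

definition mdeg :: "('n::finite \<Rightarrow> nat) \<Rightarrow> nat" where
  "mdeg e = (\<Sum>i\<in>UNIV. e i)"

instantiation mps :: (ab_group_add, type) ab_group_add
begin

definition "0 = Abs_mps (\<lambda>_. 0)"
definition "f + g = Abs_mps (\<lambda>e. mps_nth f e + mps_nth g e)"
definition "f - g = Abs_mps (\<lambda>e. mps_nth f e - mps_nth g e)"
definition "- f = Abs_mps (\<lambda>e. - mps_nth f e)"

instance
  by standard
     (simp_all add: mps_eq_iff zero_mps_def plus_mps_def minus_mps_def uminus_mps_def algebra_simps)

end

lemma mps_nth_0 [simp]: "mps_nth 0 e = 0"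
  and mps_nth_add [simp]: "mps_nth (f + g) e = mps_nth f e + mps_nth g e"
  and mps_nth_diff [simp]: "mps_nth (f - g) e = mps_nth f e - mps_nth g e"
  and mps_nth_uminus [simp]: "mps_nth (- f) e = - mps_nth f e"
  by (simp_all add: zero_mps_def plus_mps_def minus_mps_def uminus_mps_def)

lemma finite_atMost_exponent [simp]: "finite {..e :: 'n::finite \<Rightarrow> nat}"
proof -
  have "{..e} = PiE UNIV (\<lambda>i. {..e i})"
    by (auto simp: le_fun_def PiE_iff)
  then show ?thesis
    by (simp add: finite_PiE)
qed

instantiation mps :: (comm_ring_1, finite) comm_ring_1
begin

definition "1 = Abs_mps (\<lambda>e. if e = (\<lambda>_. 0) then 1 else 0)"
definition "f * g = Abs_mps (\<lambda>e. \<Sum>a\<le>e. mps_nth f a * mps_nth g (e - a))"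

instance
proof
  fix f g h :: "('a, 'b) mps"
  have assoc: "(\<Sum>a\<le>e. (\<Sum>b\<le>a. mps_nth f b * mps_nth g (a - b)) * mps_nth h (e - a)) =
        (\<Sum>b\<le>e. mps_nth f b * (\<Sum>c\<le>e - b. mps_nth g c * mps_nth h (e - b - c)))"
    (is "?L = ?R") for e
  proof -
    have "?L = (\<Sum>(a, b)\<in>Sigma {..e} (\<lambda>a. {..a}).
                  mps_nth f b * mps_nth g (a - b) * mps_nth h (e - a))"
      by (simp add: sum_distrib_right sum.Sigma)
    also have "\<dots> = (\<Sum>(b, c)\<in>Sigma {..e} (\<lambda>b. {..e - b}).
                  mps_nth f b * (mps_nth g c * mps_nth h (e - b - c)))"
    proof (rule sum.reindex_bij_witness[where i = "\<lambda>(b, c). (\<lambda>i. b i + c i, b)"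
            and j = "\<lambda>(a, b). (b, a - b)"], goal_cases)
      case (1 x) then show ?case
        by (auto simp: le_fun_def fun_eq_iff)
    next
      case (2 x) then show ?case
        by (auto simp: le_fun_def intro: order_trans intro!: diff_le_mono)
    next
      case (3 x) then show ?case
        by (auto simp: fun_eq_iff)
    next
      case (4 x) then show ?case
        by (auto simp: le_fun_def) (metis add.commute add_le_mono le_add_diff_inverse nat_add_left_cancel_le)
    next
      case (5 x)
      obtain a b where x: "x = (a, b)" "a \<le> e" "b \<le> a" using 5 by auto
      then have "e - b - (a - b) = e - a"
        by (auto simp: fun_eq_iff le_fun_def)
      then show ?case by (simp add: x mult.assoc)
    qed
    also have "\<dots> = ?R"
      by (simp add: sum_distrib_left sum.Sigma)
    finally show ?thesis .
  qed
  show "f * g * h = f * (g * h)"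
    using assoc by (simp add: mps_eq_iff times_mps_def)
  have comm: "(\<Sum>a\<le>e. mps_nth f a * mps_nth g (e - a)) = (\<Sum>a\<le>e. mps_nth g a * mps_nth f (e - a))" for e
  proof (rule sum.reindex_bij_witness[where i = "\<lambda>a. e - a" and j = "\<lambda>a. e - a"], goal_cases)
    case (5 a)
    then have "e - (e - a) = a" by (auto simp: fun_eq_iff le_fun_def)
    then show ?case by (simp add: mult.commute)
  qed (auto simp: fun_eq_iff le_fun_def)
  show "f * g = g * f"
    using comm by (simp add: mps_eq_iff times_mps_def)
  show "(f + g) * h = f * h + g * h"
    by (simp add: mps_eq_iff times_mps_def distrib_right sum.distrib)
  have "(\<Sum>a\<le>e. (if a = (\<lambda>_. 0) then 1 else 0) * mps_nth f (e - a)) = mps_nth f e" for e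
  proof -
    have "(\<Sum>a\<le>e. (if a = (\<lambda>_. 0) then 1 else 0) * mps_nth f (e - a)) =
          (\<Sum>a\<in>{\<lambda>_. 0}. (if a = (\<lambda>_. 0) then 1 else 0) * mps_nth f (e - a))"
      by (rule sum.mono_neutral_right) (auto simp: le_fun_def)
    also have "\<dots> = mps_nth f e"
      by (simp add: fun_diff_def)
    finally show ?thesis .
  qed
  then show "1 * f = f"
    by (simp add: mps_eq_iff times_mps_def one_mps_def)
  show "(0 :: ('a, 'b) mps) \<noteq> 1"
    by (auto simp: mps_eq_iff one_mps_def)
qed

end

definition mps_X :: "'n::finite \<Rightarrow> ('a::comm_ring_1, 'n) mps" where
  "mps_X i = Abs_mps (\<lambda>e. if e = (\<lambda>j. if j = i then 1 else 0) then 1 else 0)"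

definition mps_deriv :: "'n::finite \<Rightarrow> ('a::comm_ring_1, 'n) mps \<Rightarrow> ('a, 'n) mps" where
  "mps_deriv i f = Abs_mps (\<lambda>e. of_nat (Suc (e i)) * mps_nth f (e(i := Suc (e i))))"

lemma mps_deriv_commute: "mps_deriv i (mps_deriv j f) = mps_deriv j (mps_deriv i f)"
  by (cases "i = j") (simp_all add: mps_eq_iff mps_deriv_def fun_upd_twist mult.left_commute)

text \<open>
  Substitution of a system \<open>G\<close> into a series \<open>f\<close>, that is
  \<open>\<Sum>e. f\<^sub>e \<Prod>i. G i ^ e i\<close>. It is only meaningful if every \<open>G i\<close> has zero constant term;
  then \<open>\<Prod>i. G i ^ e i\<close> has no terms of degree below \<open>mdeg e\<close>, so the coefficient at \<open>d\<close>
  only involves the exponents \<open>e\<close> with \<open>mdeg e \<le> mdeg d\<close>.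
\<close>

definition mps_compose ::
    "('a::comm_ring_1, 'n::finite) mps \<Rightarrow> ('n \<Rightarrow> ('a, 'n) mps) \<Rightarrow> ('a, 'n) mps" where
  "mps_compose f G = Abs_mps (\<lambda>d. \<Sum>e | mdeg e \<le> mdeg d.
      mps_nth f e * mps_nth (\<Prod>i\<in>UNIV. G i ^ e i) d)"

definition special_type :: "('n::finite \<Rightarrow> ('a::comm_ring_1, 'n) mps) \<Rightarrow> bool" where
  "special_type F \<longleftrightarrow> (\<forall>i e. mdeg e < 2 \<longrightarrow> mps_nth (F i) e = mps_nth (mps_X i) e)"

definition formal_inverse ::
    "('n::finite \<Rightarrow> ('a::comm_ring_1, 'n) mps) \<Rightarrow> ('n \<Rightarrow> ('a, 'n) mps) \<Rightarrow> bool" where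
  "formal_inverse F G \<longleftrightarrow> special_type G \<and>
     (\<forall>i. mps_compose (F i) G = mps_X i) \<and> (\<forall>i. mps_compose (G i) F = mps_X i)"


section \<open>The adic topology\<close>

text \<open>
  Basic neighbourhoods of \<open>f\<close> are the cosets of the powers of the ideal generated by the
  variables: all series that agree with \<open>f\<close> in degrees below \<open>N\<close>. Infinite sums of power series,
  in the sense of \<open>has_sum\<close> and \<open>infsum\<close>, are taken with respect to this topology.
\<close>

instantiation mps :: (type, finite) topological_space
begin

definition open_mps :: "('a, 'b) mps set \<Rightarrow> bool" where
  "open_mps U \<longleftrightarrow>
     (\<forall>f\<in>U. \<exists>N. \<forall>g. (\<forall>e. mdeg e < N \<longrightarrow> mps_nth g e = mps_nth f e) \<longrightarrow> g \<in> U)"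

instance
proof
  show "open (UNIV :: ('a, 'b) mps set)"
    by (simp add: open_mps_def)
next
  fix S T :: "('a, 'b) mps set"
  assume S: "open S" and T: "open T"
  show "open (S \<inter> T)"
    unfolding open_mps_def
  proof
    fix f assume "f \<in> S \<inter> T"
    then obtain M N where
      "\<forall>g. (\<forall>e. mdeg e < M \<longrightarrow> mps_nth g e = mps_nth f e) \<longrightarrow> g \<in> S"
      "\<forall>g. (\<forall>e. mdeg e < N \<longrightarrow> mps_nth g e = mps_nth f e) \<longrightarrow> g \<in> T"
      using S T by (auto simp: open_mps_def) metis
    then show "\<exists>N. \<forall>g. (\<forall>e. mdeg e < N \<longrightarrow> mps_nth g e = mps_nth f e) \<longrightarrow> g \<in> S \<inter> T"
      by (intro exI[of _ "max M N"]) auto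
  qed
next
  fix K :: "('a, 'b) mps set set"
  assume "\<forall>S\<in>K. open S"
  then show "open (\<Union> K)"
    unfolding open_mps_def by (meson Union_iff)
qed

end

instance mps :: (type, finite) t2_space
proof
  fix f g :: "('a, 'b) mps"
  assume "f \<noteq> g"
  then obtain e where e: "mps_nth f e \<noteq> mps_nth g e"
    by (auto simp: mps_eq_iff)
  define B where "B h = {k. mps_nth k e = mps_nth h e}" for h :: "('a, 'b) mps"
  have "open (B h)" for h
    unfolding open_mps_def B_def by (auto intro!: exI[of _ "Suc (mdeg e)"])
  then show "\<exists>U V. open U \<and> open V \<and> f \<in> U \<and> g \<in> V \<and> U \<inter> V = {}"
    using e by (intro exI[of _ "B f"] exI[of _ "B g"]) (auto simp: B_def)
qed


section \<open>Algebras over the rationals\<close>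

locale rat_algebra = vector_space qscale
  for qscale :: "rat \<Rightarrow> 'a::comm_ring_1 \<Rightarrow> 'a" +
  assumes qscale_mult_left: "qscale r (x * y) = qscale r x * y"

definition mps_scale :: "(rat \<Rightarrow> 'a \<Rightarrow> 'a) \<Rightarrow> rat \<Rightarrow> ('a, 'n) mps \<Rightarrow> ('a, 'n) mps" where
  "mps_scale qscale r f = Abs_mps (\<lambda>e. qscale r (mps_nth f e))"


section \<open>Free trees\<close>

text \<open>A graph is a pair of a vertex set and a set of edges, each edge being a two-element set.\<close>

type_synonym 'v graph = "'v set \<times> 'v set set"

abbreviation verts :: "'v graph \<Rightarrow> 'v set" where "verts \<equiv> fst"
abbreviation edges :: "'v graph \<Rightarrow> 'v set set" where "edges \<equiv> snd"

definition simple_graph :: "'v graph \<Rightarrow> bool" where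
  "simple_graph T \<longleftrightarrow> finite (verts T) \<and> (\<forall>e\<in>edges T. e \<subseteq> verts T \<and> card e = 2)"

definition connected_graph :: "'v graph \<Rightarrow> bool" where
  "connected_graph T \<longleftrightarrow> verts T \<noteq> {} \<and>
     (\<forall>u\<in>verts T. \<forall>v\<in>verts T. (u, v) \<in> {(x, y). {x, y} \<in> edges T}\<^sup>*)"

definition graph_cycle :: "'v graph \<Rightarrow> 'v list \<Rightarrow> bool" where
  "graph_cycle T vs \<longleftrightarrow> 3 \<le> length vs \<and> distinct vs \<and>
     (\<forall>k<length vs. {vs ! k, vs ! (Suc k mod length vs)} \<in> edges T)"

definition is_tree :: "'v graph \<Rightarrow> bool" where
  "is_tree T \<longleftrightarrow> simple_graph T \<and> connected_graph T \<and> (\<nexists>vs. graph_cycle T vs)"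

definition graph_iso :: "'v graph \<Rightarrow> 'w graph \<Rightarrow> bool" where
  "graph_iso T T' \<longleftrightarrow>
     (\<exists>f. bij_betw f (verts T) (verts T') \<and> (\<lambda>e. f ` e) ` edges T = edges T')"

lemma graph_iso_refl: "graph_iso T T"
  unfolding graph_iso_def by (intro exI[of _ id]) simp

lemma graph_iso_sym:
  assumes "simple_graph T" "graph_iso T T'"
  shows "graph_iso T' T"
proof -
  obtain f where f: "bij_betw f (verts T) (verts T')" "(\<lambda>e. f ` e) ` edges T = edges T'"
    using assms(2) by (auto simp: graph_iso_def)
  let ?g = "inv_into (verts T) f"
  have "?g ` f ` e = e" if "e \<in> edges T" for e
    using assms(1) f(1) that by (simp add: simple_graph_def bij_betw_def inv_into_image_cancel)
  then have "(\<lambda>e. ?g ` e) ` edges T' = edges T"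
    by (simp add: image_image flip: f(2))
  then show ?thesis
    using bij_betw_inv_into[OF f(1)] by (auto simp: graph_iso_def)
qed

lemma graph_iso_trans:
  assumes "graph_iso T T'" "graph_iso T' T''"
  shows "graph_iso T T''"
proof -
  obtain f g where fg: "bij_betw f (verts T) (verts T')" "(\<lambda>e. f ` e) ` edges T = edges T'"
    "bij_betw g (verts T') (verts T'')" "(\<lambda>e. g ` e) ` edges T' = edges T''"
    using assms by (auto simp: graph_iso_def)
  have "(\<lambda>e. (g \<circ> f) ` e) ` edges T = (\<lambda>e. g ` e) ` (\<lambda>e. f ` e) ` edges T"
    by (simp add: image_image o_def)
  then show ?thesis
    unfolding graph_iso_def
    using fg by (intro exI[of _ "g \<circ> f"]) (simp add: bij_betw_trans)
qed

definition graph_aut :: "'v graph \<Rightarrow> ('v \<Rightarrow> 'v) set" where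
  "graph_aut T = {p. p permutes verts T \<and> (\<lambda>e. p ` e) ` edges T = edges T}"

text \<open>Every finite tree is isomorphic to one whose vertices are natural numbers.\<close>

definition tree_iso_rel :: "(nat graph \<times> nat graph) set" where
  "tree_iso_rel = {(T, T'). is_tree T \<and> is_tree T' \<and> graph_iso T T'}"

lemma equiv_tree_iso_rel: "equiv {T. is_tree T} tree_iso_rel"
proof (rule equivI)
  show "refl_on {T. is_tree T} tree_iso_rel"
    by (auto simp: refl_on_def tree_iso_rel_def graph_iso_refl)
  show "sym tree_iso_rel"
    by (auto simp: sym_def tree_iso_rel_def is_tree_def intro: graph_iso_sym)
  show "trans tree_iso_rel"
    by (auto simp: trans_def tree_iso_rel_def intro: graph_iso_trans)
qed (auto simp: tree_iso_rel_def)

definition free_trees :: "nat graph set set" where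
  "free_trees = {T. is_tree T} // tree_iso_rel"

definition tree_rep :: "nat graph set \<Rightarrow> nat graph" where
  "tree_rep C = (SOME T. T \<in> C)"


section \<open>The series attached to a tree\<close>

definition adj :: "'v graph \<Rightarrow> 'v \<Rightarrow> 'v set set" where
  "adj T v = {e \<in> edges T. v \<in> e}"

text \<open>
  The composite of the operators \<open>mps_deriv (l e)\<close> over \<open>e \<in> A\<close>; the order of composition is
  irrelevant since partial derivatives commute.
\<close>

definition D_edges ::
    "('v set \<Rightarrow> 'n::finite) \<Rightarrow> 'v set set \<Rightarrow> ('a::comm_ring_1, 'n) mps \<Rightarrow> ('a, 'n) mps" where
  "D_edges l A P = Finite_Set.fold (\<lambda>e. mps_deriv (l e)) P A"

lemma D_edges_empty [simp]: "D_edges l {} P = P"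
  by (simp add: D_edges_def)

lemma D_edges_insert [simp]:
  assumes "finite A" "e \<notin> A"
  shows "D_edges l (insert e A) P = mps_deriv (l e) (D_edges l A P)"
proof -
  interpret comp_fun_commute "\<lambda>e. mps_deriv (l e)"
    by standard (simp add: fun_eq_iff mps_deriv_commute)
  show ?thesis
    using assms by (simp add: D_edges_def)
qed

definition tree_series ::
    "'v graph \<Rightarrow> ('a::comm_ring_1, 'n::finite) mps \<Rightarrow> ('a, 'n) mps" where
  "tree_series T P = (\<Sum>l\<in>edges T \<rightarrow>\<^sub>E UNIV. \<Prod>v\<in>verts T. D_edges l (adj T v) P)"

definition tree_term ::
    "(rat \<Rightarrow> 'a::comm_ring_1 \<Rightarrow> 'a) \<Rightarrow> ('a, 'n::finite) mps \<Rightarrow> 'v graph \<Rightarrow> ('a, 'n) mps" where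
  "tree_term qscale P T = mps_scale qscale (1 / of_nat (card (graph_aut T))) (tree_series T P)"

end

theory Submission imports Defs "HOL-Computational_Algebra.Polynomial_FPS" begin

text \<open>
  Orbit-stabilizer turns the sum over isomorphism classes into a sum over labelled trees, divided
  by \<open>n!\<close>. Marking an oriented edge and deleting it splits a tree into two rooted trees, so if
  \<open>Q\<^sub>s\<close> gives each edge the weight \<open>s\<close>, then \<open>2 \<partial>\<^sub>s Q\<^sub>s = \<Sum>j. (D\<^sub>j Q\<^sub>s)\<^sup>2\<close> with \<open>Q\<^sub>0 = P\<close>. Its
  gradient solves the inviscid Burgers equation, whose solution is constant along the
  characteristics \<open>X - s \<nabla>P\<close>; at \<open>s = 1\<close> this says that \<open>X + \<nabla>Q\<close> is a left inverse of \<open>F\<close>.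
  Composition with \<open>F\<close> on the right is injective, so \<open>G = X + \<nabla>Q\<close>. The series converges because
  leaves contribute degree at least two and vertices of valency two degree at least one, which
  by the count of edges gives degree at least \<open>n + 2\<close> for a tree with \<open>n \<ge> 2\<close> vertices.
\<close>

section \<open>Order, derivations and substitution\<close>

text \<open>Labelled trees have no symmetries to account for: after a cut, the two pieces are told
  apart by their vertex sets, whereas on isomorphism classes each cut would have to be weighed
  against the automorphisms of the pieces. Dividing by \<open>n!\<close> turns the sum over vertex
  subsets into a product of exponential generating functions. The factor 2 stems from counting both
  orientations of the marked edge. The weight \<open>s\<close> embeds the inversion formula, which
  has no parameter of its own, in a differential equation determined by its initial value.
  \<open>K\<close> may have zero divisors and carries no topology, so derivatives are formal and
  only positive integers are divided by. Setting \<open>s = 1\<close> is legitimate because in each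
  degree in \<open>X\<close> only finitely many trees occur. The direction of the characteristics
  comes from applying \<open>D_i\<close> and halving: the \<open>s\<close>-derivative of
  \<open>U_i\<close> is the sum of \<open>U_j D_j U_i\<close>, so \<open>U\<close> is constant along
  motion with velocity \<open>-U\<close>. Starting from \<open>U = \<nabla>P\<close>, this motion is
  \<open>X - s \<nabla>P\<close>, which is \<open>F\<close> at \<open>s = 1\<close>.\<close>

lemma mps_nth_1: "mps_nth 1 e = (if e = (\<lambda>_. 0) then 1 else 0)"
  by (simp add: one_mps_def)

lemma mps_nth_mult: "mps_nth (f * g) e = (\<Sum>a\<le>e. mps_nth f a * mps_nth g (e - a))"
  by (simp add: times_mps_def)

lemma mps_nth_deriv: "mps_nth (mps_deriv i f) e = of_nat (Suc (e i)) * mps_nth f (e(i := Suc (e i)))"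
  by (simp add: mps_deriv_def)

lemma mps_nth_sum: "mps_nth (\<Sum>x\<in>A. f x) e = (\<Sum>x\<in>A. mps_nth (f x) e)"
  by (induction A rule: infinite_finite_induct) auto

lemma mdeg_add: "mdeg (\<lambda>i. a i + b i) = mdeg a + mdeg b"
  by (simp add: mdeg_def sum.distrib)

lemma mdeg_diff: "a \<le> e \<Longrightarrow> mdeg (e - a) = mdeg e - mdeg a"
  by (simp add: mdeg_def le_fun_def sum_subtractf_nat)

lemma mdeg_mono: "a \<le> e \<Longrightarrow> mdeg a \<le> mdeg e"
  by (simp add: mdeg_def le_fun_def sum_mono)

lemma mdeg_upd_Suc: "mdeg (e(i := Suc (e i))) = Suc (mdeg e)"
proof -
  have "mdeg (e(i := Suc (e i))) = (\<Sum>j\<in>UNIV. e j + (if j = i then 1 else 0))"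
    unfolding mdeg_def by (rule sum.cong) auto
  then show ?thesis by (simp add: sum.distrib mdeg_def)
qed

lemma mdeg_unit: "mdeg (\<lambda>j. if j = i then 1 else 0) = 1"
  by (simp add: mdeg_def)

lemma mdeg_eq_0_iff: "mdeg e = 0 \<longleftrightarrow> e = (\<lambda>_. 0)"
  by (auto simp: mdeg_def)

lemma finite_mdeg_le [simp]: "finite {e :: 'n::finite \<Rightarrow> nat. mdeg e \<le> M}"
proof (rule finite_subset)
  show "{e :: 'n \<Rightarrow> nat. mdeg e \<le> M} \<subseteq> {..(\<lambda>_. M)}"
    unfolding mdeg_def
  proof clarify
    fix e :: "'n \<Rightarrow> nat" assume "sum e UNIV \<le> M"
    then show "e \<le> (\<lambda>_. M)"
      by (auto simp: le_fun_def intro: order_trans[OF member_le_sum[of _ UNIV e]])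
  qed
qed simp

text \<open>A lower bound instead of an order function, so that the zero series needs no infinite
  value. It expresses membership in the \<open>k\<close>-th power of the ideal generated by the
  variables.\<close>

definition mps_ord_ge :: "('a::comm_ring_1, 'n::finite) mps \<Rightarrow> nat \<Rightarrow> bool" where
  "mps_ord_ge f k \<longleftrightarrow> (\<forall>e. mdeg e < k \<longrightarrow> mps_nth f e = 0)"

lemma mps_ord_geD: "mps_ord_ge f k \<Longrightarrow> mdeg e < k \<Longrightarrow> mps_nth f e = 0"
  by (simp add: mps_ord_ge_def)

lemma mps_ord_ge_0 [simp]: "mps_ord_ge f 0"
  by (simp add: mps_ord_ge_def)

lemma mps_ord_ge_mono: "mps_ord_ge f k \<Longrightarrow> l \<le> k \<Longrightarrow> mps_ord_ge f l"
  by (auto simp: mps_ord_ge_def)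

lemma mps_ord_ge_add: "mps_ord_ge f k \<Longrightarrow> mps_ord_ge g k \<Longrightarrow> mps_ord_ge (f + g) k"
  by (auto simp: mps_ord_ge_def)

lemma mps_ord_ge_sum: "(\<And>x. x \<in> A \<Longrightarrow> mps_ord_ge (f x) k) \<Longrightarrow> mps_ord_ge (\<Sum>x\<in>A. f x) k"
  by (auto simp: mps_ord_ge_def mps_nth_sum)

lemma mps_ord_ge_mult:
  assumes "mps_ord_ge f k" "mps_ord_ge g l"
  shows "mps_ord_ge (f * g) (k + l)"
  unfolding mps_ord_ge_def
proof (intro allI impI)
  fix e :: "'b \<Rightarrow> nat" assume e: "mdeg e < k + l"
  show "mps_nth (f * g) e = 0"
    unfolding mps_nth_mult
  proof (rule sum.neutral, rule ballI)
    fix a assume "a \<in> {..e}"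
    then have "a \<le> e" by simp
    then have "mdeg (e - a) = mdeg e - mdeg a" "mdeg a \<le> mdeg e"
      by (auto simp: mdeg_diff mdeg_mono)
    with e have "mdeg a < k \<or> mdeg (e - a) < l" by linarith
    then show "mps_nth f a * mps_nth g (e - a) = 0"
      using assms by (auto simp: mps_ord_ge_def)
  qed
qed

lemma mps_ord_ge_prod:
  "(\<And>x. x \<in> A \<Longrightarrow> mps_ord_ge (f x) (k x)) \<Longrightarrow> mps_ord_ge (\<Prod>x\<in>A. f x) (\<Sum>x\<in>A. k x)"
  by (induction A rule: infinite_finite_induct) (auto intro: mps_ord_ge_mult)

lemma mps_ord_ge_deriv: "mps_ord_ge f k \<Longrightarrow> mps_ord_ge (mps_deriv i f) (k - 1)"
  by (auto simp: mps_ord_ge_def mps_nth_deriv mdeg_upd_Suc)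

section \<open>Monomials evaluated at a system, and substitution\<close>

definition mps_pow :: "('n::finite \<Rightarrow> ('a::comm_ring_1, 'n) mps) \<Rightarrow> ('n \<Rightarrow> nat) \<Rightarrow> ('a, 'n) mps" where
  "mps_pow F e = (\<Prod>i\<in>UNIV. F i ^ e i)"

lemma mps_pow_add: "mps_pow F (\<lambda>i. a i + b i) = mps_pow F a * mps_pow F b"
  by (simp add: mps_pow_def power_add prod.distrib)

lemma mps_pow_zero: "mps_pow F (\<lambda>_. 0) = 1"
  by (simp add: mps_pow_def)

lemma mps_pow_unit: "mps_pow F (\<lambda>j. if j = i then 1 else 0) = F i"
proof -
  have "mps_pow F (\<lambda>j. if j = i then 1 else 0) = (\<Prod>j\<in>UNIV. if j = i then F j else 1)"
    unfolding mps_pow_def by (rule prod.cong) auto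
  then show ?thesis by simp
qed

lemma mps_pow_upd_Suc: "mps_pow F (e(i := Suc (e i))) = F i * mps_pow F e"
proof -
  have "e(i := Suc (e i)) = (\<lambda>j. (if j = i then 1 else 0) + e j)"
    by auto
  then show ?thesis
    using mps_pow_add[of F "\<lambda>j. if j = i then 1 else 0" e] by (simp add: mps_pow_unit)
qed

text \<open>A non-zero exponent has a positive entry, and lowering that entry decreases the total
  degree. Claims on \<open>mps_pow F e\<close> thus reduce to multiplication by a single
  \<open>F i\<close>.\<close>

lemma mdeg_induct [case_names zero Suc]:
  fixes e :: "'n::finite \<Rightarrow> nat"
  assumes "P (\<lambda>_. 0)" and "\<And>e i. P e \<Longrightarrow> P (e(i := Suc (e i)))"
  shows "P e"
proof (induction "mdeg e" arbitrary: e)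
  case 0
  then show ?case using assms(1) mdeg_eq_0_iff[of e] by simp
next
  case (Suc m)
  then obtain i where i: "e i \<noteq> 0"
    by (metis mdeg_eq_0_iff nat.distinct(1) ext)
  define e' where "e' = e(i := e i - 1)"
  have e: "e = e'(i := Suc (e' i))"
    using i by (auto simp: e'_def)
  with Suc have "m = mdeg e'"
    by (metis mdeg_upd_Suc nat.inject)
  then show ?case
    using Suc(1) assms(2) e by metis
qed

lemma mps_ord_ge_pow:
  assumes "\<And>i. mps_ord_ge (F i) 1"
  shows "mps_ord_ge (mps_pow F e) (mdeg e)"
proof (induction e rule: mdeg_induct)
  case zero
  then show ?case by (simp add: mdeg_def)
next
  case (Suc e i)
  then show ?case
    using mps_ord_ge_mult[OF assms[of i] Suc] by (simp add: mps_pow_upd_Suc mdeg_upd_Suc del: fun_upd_apply)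
qed

text \<open>Exponents beyond \<open>mdeg d\<close> contribute nothing because
  \<open>mps_pow F e\<close> has order at least \<open>mdeg e\<close>. The free bound
  \<open>M\<close> allows coefficients at different \<open>d\<close> to share one index set.\<close>

lemma mps_nth_compose:
  assumes F: "\<And>i. mps_ord_ge (F i) 1" and d: "mdeg d \<le> M"
  shows "mps_nth (mps_compose f F) d = (\<Sum>e | mdeg e \<le> M. mps_nth f e * mps_nth (mps_pow F e) d)"
proof -
  have "mps_nth (mps_compose f F) d = (\<Sum>e | mdeg e \<le> mdeg d. mps_nth f e * mps_nth (mps_pow F e) d)"
    by (simp add: mps_compose_def mps_pow_def)
  also have "\<dots> = (\<Sum>e | mdeg e \<le> M. mps_nth f e * mps_nth (mps_pow F e) d)"
    using d by (intro sum.mono_neutral_left)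
      (auto simp: mps_ord_geD[OF mps_ord_ge_pow, OF F])
  finally show ?thesis .
qed

text \<open>The product involves the coefficients of the substitution at all
  \<open>a \<le> d\<close>; with the common bound \<open>M\<close> for them the two sums can be
  interchanged.\<close>

lemma mps_nth_compose_mult:
  assumes F: "\<And>i. mps_ord_ge (F i) 1" and d: "mdeg d \<le> M"
  shows "mps_nth (mps_compose f F * h) d = (\<Sum>e | mdeg e \<le> M. mps_nth f e * mps_nth (mps_pow F e * h) d)"
proof -
  have "mps_nth (mps_compose f F * h) d =
      (\<Sum>a\<le>d. (\<Sum>e | mdeg e \<le> M. mps_nth f e * mps_nth (mps_pow F e) a) * mps_nth h (d - a))"
    unfolding mps_nth_mult
    using d by (intro sum.cong refl) (simp add: mps_nth_compose[OF F order_trans[OF mdeg_mono]])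
  also have "\<dots> = (\<Sum>e | mdeg e \<le> M. \<Sum>a\<le>d. mps_nth f e * mps_nth (mps_pow F e) a * mps_nth h (d - a))"
    by (simp add: sum_distrib_right) (rule sum.swap)
  also have "\<dots> = (\<Sum>e | mdeg e \<le> M. mps_nth f e * mps_nth (mps_pow F e * h) d)"
    by (simp add: mps_nth_mult sum_distrib_left mult.assoc)
  finally show ?thesis .
qed

lemma mps_compose_add: "mps_compose (f + g) F = mps_compose f F + mps_compose g F"
  by (simp add: mps_eq_iff mps_compose_def distrib_right sum.distrib)

lemma mps_compose_diff: "mps_compose (f - g) F = mps_compose f F - mps_compose g F"
  by (simp add: mps_eq_iff mps_compose_def left_diff_distrib sum_subtractf)

lemma mps_compose_sum: "mps_compose (\<Sum>x\<in>A. f x) F = (\<Sum>x\<in>A. mps_compose (f x) F)"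
proof (induction A rule: infinite_finite_induct)
  case (insert x A)
  then show ?case by (simp add: mps_compose_add)
qed (simp_all add: mps_eq_iff mps_compose_def)

text \<open>Both sides expand into terms indexed by pairs of exponents \<open>(a, b)\<close> with
  the monomial of exponent \<open>a + b\<close>. The left side has only pairs of total degree at
  most \<open>?M\<close>, the right side a full square; the extra pairs vanish by the order of that
  monomial.\<close>

lemma mps_compose_mult:
  fixes F :: "'b::finite \<Rightarrow> ('a::comm_ring_1, 'b) mps"
  assumes F: "\<And>i. mps_ord_ge (F i) 1"
  shows "mps_compose (f * g) F = mps_compose f F * mps_compose g F"
proof (rule mps_ext)
  fix d :: "'b \<Rightarrow> nat"
  let ?M = "mdeg d"
  let ?S = "{e. mdeg e \<le> ?M}"
  let ?t = "\<lambda>a b. mps_nth f a * (mps_nth g b * mps_nth (mps_pow F (\<lambda>i. a i + b i)) d)"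
  have "mps_nth (mps_compose (f * g) F) d =
      (\<Sum>e\<in>?S. \<Sum>a\<le>e. mps_nth f a * (mps_nth g (e - a) * mps_nth (mps_pow F e) d))"
    by (simp add: mps_nth_compose[OF F order_refl] mps_nth_mult sum_distrib_right mult.assoc)
  also have "\<dots> = (\<Sum>(e, a)\<in>Sigma ?S (\<lambda>e. {..e}). mps_nth f a * (mps_nth g (e - a) * mps_nth (mps_pow F e) d))"
    by (simp add: sum.Sigma)
  also have "\<dots> = (\<Sum>(a, b)\<in>{(a, b). mdeg a + mdeg b \<le> ?M}. ?t a b)"
    by (rule sum.reindex_bij_witness[where i = "\<lambda>(a, b). (\<lambda>i. a i + b i, a)" and j = "\<lambda>(e, a). (a, e - a)"])
       (auto simp: mdeg_add mdeg_diff fun_eq_iff le_fun_def mdeg_mono dest!: mdeg_mono[unfolded le_fun_def])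
  also have "\<dots> = (\<Sum>(a, b)\<in>?S \<times> ?S. ?t a b)"
  proof (rule sum.mono_neutral_left)
    have "mps_nth (mps_pow F (\<lambda>i. a i + b i)) d = 0" if "\<not> mdeg a + mdeg b \<le> ?M" for a b
      using that mps_ord_geD[OF mps_ord_ge_pow[OF F], of d "\<lambda>i. a i + b i"] by (simp add: mdeg_add)
    then show "\<forall>x\<in>?S \<times> ?S - {(a, b). mdeg a + mdeg b \<le> ?M}. (case x of (a, b) \<Rightarrow> ?t a b) = 0"
      by (simp add: split_beta)
  qed auto
  also have "\<dots> = (\<Sum>a\<in>?S. mps_nth f a * (\<Sum>b\<in>?S. mps_nth g b * mps_nth (mps_pow F b * mps_pow F a) d))"
    by (simp add: sum.cartesian_product[symmetric] sum_distrib_left mps_pow_add mult.commute)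
  also have "\<dots> = mps_nth (mps_compose f F * mps_compose g F) d"
    by (simp add: mps_nth_compose_mult[OF F order_refl] mult.commute[of "mps_pow F _" "mps_compose g F"])
  finally show "mps_nth (mps_compose (f * g) F) d = mps_nth (mps_compose f F * mps_compose g F) d" .
qed

lemma mps_nth_X: "mps_nth (mps_X i) e = (if e = (\<lambda>j. if j = i then 1 else 0) then 1 else 0)"
  by (simp add: mps_X_def)

lemma mps_ord_ge_X: "mps_ord_ge (mps_X i) 1"
  by (auto simp: mps_ord_ge_def mps_nth_X mdeg_unit)

lemma mps_compose_X_left:
  assumes F: "\<And>i. mps_ord_ge (F i) 1"
  shows "mps_compose (mps_X i) F = F i"
proof (rule mps_ext)
  fix d
  \<comment> \<open>The bound is raised by one so that the unit exponent, of degree 1, lies in the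
    index set even for \<open>mdeg d = 0\<close>.\<close>
  have "mps_nth (mps_compose (mps_X i) F) d =
      (\<Sum>e | mdeg e \<le> Suc (mdeg d). mps_nth (mps_X i) e * mps_nth (mps_pow F e) d)"
    by (rule mps_nth_compose[OF F]) simp
  also have "\<dots> = (\<Sum>e | mdeg e \<le> Suc (mdeg d).
      if e = (\<lambda>j. if j = i then 1 else 0) then mps_nth (mps_pow F e) d else 0)"
    by (rule sum.cong) (simp_all add: mps_nth_X)
  also have "\<dots> = mps_nth (F i) d"
    by (subst sum.delta) (simp_all add: mdeg_unit mps_pow_unit)
  finally show "mps_nth (mps_compose (mps_X i) F) d = mps_nth (F i) d" .
qed

lemma mps_nth_X_mult:
  "mps_nth (mps_X i * f) e = (if e i = 0 then 0 else mps_nth f (e(i := e i - 1)))"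
proof -
  let ?u = "\<lambda>j. if j = i then 1 else 0 :: nat"
  have "mps_nth (mps_X i * f) e = (\<Sum>a\<le>e. if a = ?u then mps_nth f (e - a) else 0)"
    unfolding mps_nth_mult by (rule sum.cong) (simp_all add: mps_nth_X)
  also have "\<dots> = (if ?u \<le> e then mps_nth f (e - ?u) else 0)"
    by (subst sum.delta) simp_all
  also have "?u \<le> e \<longleftrightarrow> e i \<noteq> 0"
    by (auto simp: le_fun_def)
  also have "e - ?u = e(i := e i - 1)"
    by auto
  finally show ?thesis by simp
qed

lemma mps_nth_pow_X: "mps_nth (mps_pow mps_X e) d = (if d = e then 1 else 0)"
proof (induction e arbitrary: d rule: mdeg_induct)
  case zero
  then show ?case by (simp add: mps_pow_zero mps_nth_1)
next
  case (Suc e i)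
  have "d = e(i := Suc (e i)) \<longleftrightarrow> d i \<noteq> 0 \<and> d(i := d i - 1) = e"
    by (auto simp: fun_eq_iff)
  then show ?case
    unfolding mps_pow_upd_Suc mps_nth_X_mult Suc by (cases "d i = 0") (simp_all only: simp_thms if_True if_False)
qed

lemma mps_compose_X_right: "mps_compose f mps_X = f"
  by (auto intro!: mps_ext
      simp: mps_nth_compose[OF mps_ord_ge_X order_refl] mps_nth_pow_X if_distrib cong: if_cong)

section \<open>Substitution of systems of special type\<close>

lemma special_type_ord_ge:
  assumes "special_type F"
  shows "mps_ord_ge (F i) 1" "mps_ord_ge (F i - mps_X i) 2"
  using assms mps_ord_ge_X[of i] by (auto simp: special_type_def mps_ord_ge_def)

text \<open>Replacing \<open>F i\<close> by \<open>mps_X i\<close> one factor at a time changes only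
  higher terms: in the telescoped difference each summand contains either the inductive difference
  or \<open>F i - mps_X i\<close>, which gains one degree.\<close>

lemma mps_ord_ge_pow_diff:
  assumes "special_type F"
  shows "mps_ord_ge (mps_pow F e - mps_pow mps_X e) (Suc (mdeg e))"
proof (induction e rule: mdeg_induct)
  case zero
  then show ?case by (simp add: mps_pow_zero mps_ord_ge_def)
next
  case (Suc e i)
  have "F i * mps_pow F e - mps_X i * mps_pow mps_X e =
      F i * (mps_pow F e - mps_pow mps_X e) + (F i - mps_X i) * mps_pow mps_X e"
    by (simp add: algebra_simps)
  moreover have "mps_ord_ge (F i * (mps_pow F e - mps_pow mps_X e)) (Suc (Suc (mdeg e)))"
    using mps_ord_ge_mult[OF special_type_ord_ge(1)[OF assms] Suc] by simp
  moreover have "mps_ord_ge ((F i - mps_X i) * mps_pow mps_X e) (Suc (Suc (mdeg e)))"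
    using mps_ord_ge_mult[OF special_type_ord_ge(2)[OF assms] mps_ord_ge_pow[OF mps_ord_ge_X]] by simp
  ultimately show ?case
    by (simp add: mps_pow_upd_Suc mdeg_upd_Suc mps_ord_ge_add del: fun_upd_apply)
qed

text \<open>In the basis of monomials, substitution of \<open>F\<close> is unitriangular with
  respect to the degree.\<close>

lemma mps_nth_pow_special:
  assumes "special_type F" "mdeg d \<le> mdeg e"
  shows "mps_nth (mps_pow F e) d = (if d = e then 1 else 0)"
  using mps_ord_geD[OF mps_ord_ge_pow_diff[OF assms(1)], of d e] assms(2)
  by (simp add: mps_nth_pow_X)

text \<open>By unitriangularity, the coefficient of the composite at \<open>d\<close> is the
  coefficient of \<open>h\<close> at \<open>d\<close> plus contributions of lower degree, which
  vanish inductively.\<close>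

lemma mps_compose_special_inject:
  assumes F: "special_type F" and eq: "mps_compose f F = mps_compose g F"
  shows "f = g"
proof -
  define h where "h = f - g"
  have "mps_nth h d = 0" for d
  proof (induction "mdeg d" arbitrary: d rule: less_induct)
    case less
    have "0 = mps_nth (mps_compose h F) d"
      using eq by (simp add: h_def mps_compose_diff)
    also have "\<dots> = (\<Sum>e | mdeg e \<le> mdeg d. mps_nth h e * mps_nth (mps_pow F e) d)"
      by (rule mps_nth_compose[OF special_type_ord_ge(1)[OF F] order_refl])
    also have "\<dots> = (\<Sum>e | mdeg e \<le> mdeg d. if d = e then mps_nth h e else 0)"
      by (rule sum.cong)
        (use less in \<open>auto simp: le_less mps_nth_pow_special[OF F]\<close>)
    also have "\<dots> = mps_nth h d"
      by simp
    finally show ?case by simp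
  qed
  then show ?thesis by (simp add: mps_eq_iff h_def)
qed

text \<open>Change of coefficients, with no structure demanded of \<open>h\<close>: it serves for
  evaluation at a value of \<open>s\<close>, for differentiation in \<open>s\<close> and for the
  embedding of constants.\<close>

definition mps_map :: "('a \<Rightarrow> 'b) \<Rightarrow> ('a, 'n) mps \<Rightarrow> ('b, 'n) mps" where
  "mps_map h f = Abs_mps (\<lambda>e. h (mps_nth f e))"

lemma mps_nth_map [simp]: "mps_nth (mps_map h f) e = h (mps_nth f e)"
  by (simp add: mps_map_def)

lemma mps_map_deriv:
  fixes h :: "'a::comm_ring_1 \<Rightarrow> 'b::comm_ring_1"
  assumes h: "\<And>x y. h (x + y) = h x + h y"
  shows "mps_map h (mps_deriv i f) = mps_deriv i (mps_map h f)"
proof -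
  have "h 0 = 0" using h[of 0 0] by simp
  then have "h (of_nat n * x) = of_nat n * h x" for n x
    by (induction n) (simp_all add: h distrib_right)
  then show ?thesis
    by (simp add: mps_eq_iff mps_nth_deriv del: of_nat_Suc)
qed

text \<open>The instances are evaluation of polynomial coefficients at \<open>s = 0\<close> and at
  \<open>s = 1\<close>; both must commute with substitution.\<close>

locale ring_hom1 =
  fixes h :: "'a::comm_ring_1 \<Rightarrow> 'b::comm_ring_1"
  assumes h_1 [simp]: "h 1 = 1"
    and h_add [simp]: "h (x + y) = h x + h y"
    and h_mult [simp]: "h (x * y) = h x * h y"
begin

lemma h_0 [simp]: "h 0 = 0"
  using h_add[of 0 0] by simp

lemma h_sum: "h (\<Sum>x\<in>A. f x) = (\<Sum>x\<in>A. h (f x))"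
  by (induction A rule: infinite_finite_induct) auto

lemma h_diff [simp]: "h (x - y) = h x - h y"
  using h_add[of "x - y" y] by (simp add: algebra_simps)

lemma mps_map_1: "mps_map h 1 = 1"
  by (auto simp: mps_eq_iff mps_nth_1)

lemma mps_map_diff: "mps_map h (f - g) = mps_map h f - mps_map h g"
  by (simp add: mps_eq_iff)

lemma mps_map_mult: "mps_map h (f * g) = mps_map h f * mps_map h g"
  by (simp add: mps_eq_iff mps_nth_mult h_sum)

lemma mps_map_power: "mps_map h (f ^ n) = mps_map h f ^ n"
  by (induction n) (simp_all add: mps_map_1 mps_map_mult)

lemma mps_map_prod: "mps_map h (\<Prod>x\<in>A. f x) = (\<Prod>x\<in>A. mps_map h (f x))"
  by (induction A rule: infinite_finite_induct) (simp_all add: mps_map_1 mps_map_mult)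

lemma mps_map_compose: "mps_map h (mps_compose f F) = mps_compose (mps_map h f) (\<lambda>i. mps_map h (F i))"
proof -
  have "h (mps_nth (\<Prod>i\<in>UNIV. F i ^ e i) d) = mps_nth (\<Prod>i\<in>UNIV. mps_map h (F i) ^ e i) d" for e d
    using mps_map_prod[of "\<lambda>i. F i ^ e i" UNIV] by (simp add: mps_map_power mps_eq_iff)
  then show ?thesis
    by (simp add: mps_eq_iff mps_compose_def h_sum)
qed

end

section \<open>Partial derivatives and the Leibniz rule\<close>

lemma mps_deriv_add: "mps_deriv i (f + g) = mps_deriv i f + mps_deriv i g"
  by (simp add: mps_eq_iff mps_nth_deriv algebra_simps)

lemma mps_deriv_sum: "mps_deriv i (\<Sum>x\<in>A. f x) = (\<Sum>x\<in>A. mps_deriv i (f x))"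
  by (simp add: mps_eq_iff mps_nth_deriv mps_nth_sum sum_distrib_left)

lemma mps_deriv_1: "mps_deriv i 1 = 0"
  by (auto simp: mps_eq_iff mps_nth_deriv mps_nth_1 fun_eq_iff)

text \<open>
  In degree \<open>e\<close> both sides are sums over the decompositions of \<open>e\<close> with the \<open>i\<close>-th exponent raised
  by one; the factor \<open>e i + 1\<close> splits as the sum of the \<open>i\<close>-th exponents of the two parts.
\<close>

lemma mps_deriv_mult: "mps_deriv i (f * g) = mps_deriv i f * g + f * mps_deriv i g"
proof (rule mps_ext)
  fix e :: "'b \<Rightarrow> nat"
  let ?e = "e(i := Suc (e i))"
  let ?t = "\<lambda>a. mps_nth f a * mps_nth g (?e - a)"
  have le: "a i \<le> Suc (e i)" if "a \<le> ?e" for a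
    using that by (auto simp: le_fun_def dest: spec[of _ i])
  have "mps_nth (mps_deriv i (f * g)) e = (\<Sum>a\<le>?e. of_nat (a i + (Suc (e i) - a i)) * ?t a)"
    unfolding mps_nth_deriv mps_nth_mult sum_distrib_left
    by (rule sum.cong) (simp_all add: le del: of_nat_Suc)
  also have "\<dots> = (\<Sum>a\<le>?e. of_nat (a i) * ?t a) + (\<Sum>a\<le>?e. of_nat (Suc (e i) - a i) * ?t a)"
    by (simp only: of_nat_add distrib_right sum.distrib)
  also have "(\<Sum>a\<le>?e. of_nat (a i) * ?t a) = (\<Sum>a | a \<le> ?e \<and> a i \<noteq> 0. of_nat (a i) * ?t a)"
    by (rule sum.mono_neutral_right) auto
  also have "\<dots> = (\<Sum>a\<le>e. of_nat (Suc (a i)) * mps_nth f (a(i := Suc (a i))) * mps_nth g (e - a))"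
  proof (rule sum.reindex_bij_witness[where i = "\<lambda>a. a(i := Suc (a i))" and j = "\<lambda>a. a(i := a i - 1)"], goal_cases)
    case (5 a)
    then have "?e - a = e - a(i := a i - 1)"
      by (auto simp: fun_eq_iff)
    with 5 show ?case by (simp add: mult.assoc)
  qed (auto simp: le_fun_def split: if_splits)
  also have "\<dots> = mps_nth (mps_deriv i f * g) e"
    by (simp add: mps_nth_mult mps_nth_deriv)
  also have "(\<Sum>a\<le>?e. of_nat (Suc (e i) - a i) * ?t a) =
      (\<Sum>a\<le>e. mps_nth f a * (of_nat (Suc (e i - a i)) * mps_nth g ((e - a)(i := Suc (e i - a i)))))"
  proof (rule sum.mono_neutral_cong_right, goal_cases)
    case 2
    have "e \<le> ?e" by (simp add: le_fun_def)
    then show ?case by auto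
  next
    case 3
    \<comment> \<open>Only the \<open>i\<close>-th bound was raised, so an exponent that is not
      below \<open>e\<close> attains this bound, and the factor \<open>Suc (e i) - a i\<close> is
      zero.\<close>
    have *: "a i = Suc (e i)" if a: "a \<le> ?e" "\<not> a \<le> e" for a
    proof -
      obtain j where "\<not> a j \<le> e j" using a(2) by (auto simp: le_fun_def)
      moreover have "a j \<le> ?e j" using a(1) by (rule le_funD)
      ultimately show ?thesis by (cases "j = i") auto
    qed
    show ?case
    proof
      fix a assume "a \<in> {..?e} - {..e}"
      then have "a i = Suc (e i)" by (intro *) auto
      then show "of_nat (Suc (e i) - a i) * ?t a = 0" by simp
    qed
  next
    case (4 a)
    then have "a i \<le> e i" by (simp add: le_fun_def)
    then have "?e - a = (e - a)(i := Suc (e i - a i))" "Suc (e i) - a i = Suc (e i - a i)"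
      by (auto simp: fun_eq_iff Suc_diff_le)
    then show ?case by (simp add: mult.left_commute)
  qed simp
  also have "\<dots> = mps_nth (f * mps_deriv i g) e"
    by (simp add: mps_nth_mult mps_nth_deriv)
  finally show "mps_nth (mps_deriv i (f * g)) e = mps_nth (mps_deriv i f * g + f * mps_deriv i g) e"
    by simp
qed

lemma mps_deriv_prod:
  assumes "finite A"
  shows "mps_deriv i (\<Prod>x\<in>A. f x) = (\<Sum>u\<in>A. mps_deriv i (f u) * (\<Prod>x\<in>A - {u}. f x))"
  using assms
proof (induction A)
  case (insert y A)
  have "(\<Sum>u\<in>A. mps_deriv i (f u) * (\<Prod>x\<in>insert y A - {u}. f x)) =
      (\<Sum>u\<in>A. f y * (mps_deriv i (f u) * (\<Prod>x\<in>A - {u}. f x)))"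
  proof (rule sum.cong)
    fix u assume "u \<in> A"
    then have "insert y A - {u} = insert y (A - {u})" using insert by auto
    then show "mps_deriv i (f u) * (\<Prod>x\<in>insert y A - {u}. f x) =
      f y * (mps_deriv i (f u) * (\<Prod>x\<in>A - {u}. f x))"
      using insert by (simp add: mult.left_commute)
  qed simp
  moreover have "insert y A - {y} = A" using insert by auto
  ultimately show ?case
    using insert by (simp add: mps_deriv_mult sum_distrib_left)
qed (simp add: mps_deriv_1)

section \<open>Derivations of the coefficient ring and the chain rule\<close>

locale derivation =
  fixes d :: "'a::comm_ring_1 \<Rightarrow> 'a"
  assumes d_add [simp]: "d (x + y) = d x + d y"
    and d_mult: "d (x * y) = d x * y + x * d y"
begin

lemma d_0 [simp]: "d 0 = 0"
  using d_add[of 0 0] by simp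

lemma d_1 [simp]: "d 1 = 0"
  using d_mult[of 1 1] by simp

lemma d_sum: "d (\<Sum>x\<in>A. f x) = (\<Sum>x\<in>A. d (f x))"
  by (induction A rule: infinite_finite_induct) auto

lemma d_diff [simp]: "d (x - y) = d x - d y"
  using d_add[of "x - y" y] by (simp add: algebra_simps)

lemma mps_map_mult: "mps_map d (f * g) = mps_map d f * g + f * mps_map d g"
  by (simp add: mps_eq_iff mps_nth_mult d_sum d_mult sum.distrib)

lemma mps_map_X: "mps_map d (mps_X i) = 0"
  by (auto simp: mps_eq_iff mps_nth_X)

text \<open>When \<open>e j = 0\<close> the summand is zero, so the truncated exponent is harmless.\<close>

lemma mps_map_pow:
  "mps_map d (mps_pow F e) = (\<Sum>j\<in>UNIV. of_nat (e j) * (mps_pow F (e(j := e j - 1)) * mps_map d (F j)))"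
proof (induction e rule: mdeg_induct)
  case zero
  then show ?case by (auto simp: mps_pow_zero mps_eq_iff mps_nth_1)
next
  case (Suc e i)
  let ?e = "e(i := Suc (e i))"
  let ?t = "\<lambda>e j. of_nat (e j) * (mps_pow F (e(j := e j - 1)) * mps_map d (F j))"
  have "?t ?e j = F i * ?t e j + (if j = i then mps_map d (F i) * mps_pow F e else 0)" for j
  proof (cases "j = i")
    case True
    have "of_nat (e i) * mps_pow F e = of_nat (e i) * (F i * mps_pow F (e(i := e i - 1)))"
    proof (cases "e i")
      case (Suc m)
      then have "e = (e(i := m))(i := Suc ((e(i := m)) i))" by auto
      then have "mps_pow F e = F i * mps_pow F (e(i := m))"
        by (metis mps_pow_upd_Suc)
      then show ?thesis using Suc by simp
    qed simp
    then have "of_nat (Suc (e i)) * (mps_pow F e * mps_map d (F i)) =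
        F i * (of_nat (e i) * (mps_pow F (e(i := e i - 1)) * mps_map d (F i))) + mps_map d (F i) * mps_pow F e"
      by (simp add: distrib_right mult.assoc[symmetric] mult.commute[of "F i"])
    moreover have "?e(i := ?e i - 1) = e" by auto
    ultimately show ?thesis using True by simp
  next
    case False
    then have "?e(j := ?e j - 1) = (e(j := e j - 1))(i := Suc ((e(j := e j - 1)) i))"
      by auto
    then have "mps_pow F (?e(j := ?e j - 1)) = F i * mps_pow F (e(j := e j - 1))"
      by (metis mps_pow_upd_Suc)
    then show ?thesis using False by (simp add: algebra_simps)
  qed
  then have "(\<Sum>j\<in>UNIV. ?t ?e j) = F i * (\<Sum>j\<in>UNIV. ?t e j) + mps_map d (F i) * mps_pow F e"
    by (simp add: sum.distrib sum_distrib_left)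
  then show ?case
    by (simp add: mps_pow_upd_Suc mps_map_mult Suc del: fun_upd_apply)
qed

text \<open>The chain rule for a series and a system that both depend on \<open>s\<close>: one term
  from the coefficients of \<open>f\<close>, one from the motion of each \<open>F j\<close>.
  Lowering the exponent of a differentiated monomial at \<open>j\<close> and reindexing produces
  \<open>mps_deriv j f\<close>.\<close>

lemma mps_map_compose:
  fixes F :: "'n::finite \<Rightarrow> ('a, 'n) mps"
  assumes F: "\<And>i. mps_ord_ge (F i) 1"
  shows "mps_map d (mps_compose f F) =
    mps_compose (mps_map d f) F + (\<Sum>j\<in>UNIV. mps_compose (mps_deriv j f) F * mps_map d (F j))"
proof (rule mps_ext)
  fix x :: "'n \<Rightarrow> nat"
  let ?M = "mdeg x"
  have of_nat_mult: "mps_nth (of_nat n * g) x = of_nat n * mps_nth g x" for n g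
    by (induction n) (simp_all add: algebra_simps)
  have j: "(\<Sum>e | mdeg e \<le> ?M. mps_nth f e * mps_nth (of_nat (e j) * (mps_pow F (e(j := e j - 1)) * mps_map d (F j))) x)
      = mps_nth (mps_compose (mps_deriv j f) F * mps_map d (F j)) x" for j
  proof -
    let ?h = "mps_map d (F j)"
    have h: "mps_ord_ge ?h 1"
      using F[of j] by (simp add: mps_ord_ge_def)
    \<comment> \<open>Applying \<open>d\<close> preserves the zero constant term of
      \<open>F j\<close>, so the product has order \<open>mdeg e + 1\<close>. This settles an
      off-by-one: the reindexed sum stops below degree \<open>?M\<close>, while substitution sums up
      to \<open>?M\<close>.\<close>
    have v: "mps_nth (mps_pow F e * ?h) x = 0" if "mdeg e \<ge> ?M" for e
      using mps_ord_geD[OF mps_ord_ge_mult[OF mps_ord_ge_pow[OF F] h], of x e] that by simp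
    have "(\<Sum>e | mdeg e \<le> ?M. mps_nth f e * mps_nth (of_nat (e j) * (mps_pow F (e(j := e j - 1)) * ?h)) x)
      = (\<Sum>e | mdeg e \<le> ?M \<and> e j \<noteq> 0. mps_nth f e * mps_nth (of_nat (e j) * (mps_pow F (e(j := e j - 1)) * ?h)) x)"
      by (rule sum.mono_neutral_right) (auto simp: of_nat_mult)
    also have "\<dots> = (\<Sum>e | Suc (mdeg e) \<le> ?M. mps_nth (mps_deriv j f) e * mps_nth (mps_pow F e * ?h) x)"
    proof (rule sum.reindex_bij_witness[where i = "\<lambda>e. e(j := Suc (e j))" and j = "\<lambda>e. e(j := e j - 1)"], goal_cases)
      case (2 e)
      then have "(e(j := e j - 1))(j := Suc ((e(j := e j - 1)) j)) = e" by auto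
      then have "mdeg e = Suc (mdeg (e(j := e j - 1)))" by (metis mdeg_upd_Suc)
      with 2 show ?case by simp
    next
      case (5 e)
      then show ?case by (simp add: mps_nth_deriv of_nat_mult mult_ac fun_upd_idem)
    qed (auto simp: mdeg_upd_Suc)
    also have "\<dots> = (\<Sum>e | mdeg e \<le> ?M. mps_nth (mps_deriv j f) e * mps_nth (mps_pow F e * ?h) x)"
      by (rule sum.mono_neutral_left) (auto simp: v)
    also have "\<dots> = mps_nth (mps_compose (mps_deriv j f) F * ?h) x"
      by (simp add: mps_nth_compose_mult[OF F order_refl])
    finally show ?thesis .
  qed
  have "mps_nth (mps_map d (mps_compose f F)) x = mps_nth (mps_compose (mps_map d f) F) x +
      (\<Sum>e | mdeg e \<le> ?M. mps_nth f e * mps_nth (mps_map d (mps_pow F e)) x)"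
    by (simp add: mps_nth_compose[OF F order_refl] d_sum d_mult sum.distrib)
  also have "(\<Sum>e | mdeg e \<le> ?M. mps_nth f e * mps_nth (mps_map d (mps_pow F e)) x) =
     (\<Sum>j\<in>UNIV. mps_nth (mps_compose (mps_deriv j f) F * mps_map d (F j)) x)"
    unfolding mps_map_pow mps_nth_sum sum_distrib_left
    by (subst sum.swap) (simp only: j)
  finally show "mps_nth (mps_map d (mps_compose f F)) x = mps_nth (mps_compose (mps_map d f) F +
      (\<Sum>j\<in>UNIV. mps_compose (mps_deriv j f) F * mps_map d (F j))) x"
    by (simp add: mps_nth_sum)
qed

end

section \<open>Polynomial coefficients in the weight \<open>s\<close>, over a ring that may have
  zero divisors\<close>

definition poly_diff :: "'a::comm_ring_1 poly \<Rightarrow> 'a poly" where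
  "poly_diff p = Abs_poly (\<lambda>n. of_nat (Suc n) * coeff p (Suc n))"

lemma coeff_poly_diff: "coeff (poly_diff p) n = of_nat (Suc n) * coeff p (Suc n)"
  unfolding poly_diff_def
  by (rule coeff_Abs_poly[of "degree p", THEN fun_cong]) (simp add: coeff_eq_0)

text \<open>Polynomials embed into univariate formal power series, from which the product rule is
  inherited.\<close>

lemma fps_of_poly_diff: "fps_of_poly (poly_diff p) = fps_deriv (fps_of_poly p)"
  by (rule fps_ext) (simp add: coeff_poly_diff del: of_nat_Suc)

interpretation poly_diff: derivation poly_diff
proof
  fix p q :: "'a poly"
  show "poly_diff (p + q) = poly_diff p + poly_diff q"
    by (rule poly_eqI) (simp add: coeff_poly_diff distrib_left del: of_nat_Suc)
  show "poly_diff (p * q) = poly_diff p * q + p * poly_diff q"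
    unfolding fps_of_poly_eq_iff[symmetric]
    by (simp add: fps_of_poly_diff fps_of_poly_mult fps_of_poly_add)
qed

interpretation coeff_0: ring_hom1 "\<lambda>p. coeff p 0"
  by standard (simp_all add: coeff_mult)

interpretation poly_at_1: ring_hom1 "\<lambda>p. poly p 1"
  by standard simp_all

section \<open>Trees and bridges\<close>

text \<open>The relation of \<open>connected_graph\<close>, made a function of the edge set alone so
  that single edges can be deleted.\<close>

definition reach :: "'v set set \<Rightarrow> 'v \<Rightarrow> 'v \<Rightarrow> bool" where
  "reach E x y \<longleftrightarrow> (x, y) \<in> {(x, y). {x, y} \<in> E}\<^sup>*"

lemma reach_refl [simp]: "reach E x x"
  by (simp add: reach_def)

lemma reach_trans: "reach E x y \<Longrightarrow> reach E y z \<Longrightarrow> reach E x z"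
  by (simp add: reach_def)

lemma reach_edge: "{x, y} \<in> E \<Longrightarrow> reach E x y"
  by (auto simp: reach_def)

lemma reach_sym: "reach E x y \<Longrightarrow> reach E y x"
  unfolding reach_def by (rule symD[OF sym_rtrancl]) (auto simp: sym_def insert_commute)

lemma reach_mono: "reach E x y \<Longrightarrow> E \<subseteq> E' \<Longrightarrow> reach E' x y"
  unfolding reach_def by (erule rtrancl_mono[THEN subsetD, rotated]) auto

lemma reach_induct [consumes 1, case_names refl step]:
  assumes "reach E x y" "P x"
    "\<And>y z. reach E x y \<Longrightarrow> {y, z} \<in> E \<Longrightarrow> P y \<Longrightarrow> P z"
  shows "P y"
  using assms(1) unfolding reach_def
  by (induction rule: rtrancl_induct) (auto intro: assms(2,3) simp: reach_def)

lemma reach_closed: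
  assumes "reach E x y" "x \<in> S" "\<And>a b. a \<in> S \<Longrightarrow> {a, b} \<in> E \<Longrightarrow> b \<in> S"
  shows "y \<in> S"
  using assms(1,2) by (induction rule: reach_induct) (auto dest: assms(3))

text \<open>An edge may become a path, even a trivial one, so \<open>f\<close> may collapse a part
  of the graph to a vertex.\<close>

lemma reach_map:
  assumes "reach E x y" "\<And>a b. {a, b} \<in> E \<Longrightarrow> reach E' (f a) (f b)"
  shows "reach E' (f x) (f y)"
  using assms(1) by (induction rule: reach_induct) (auto dest: assms(2) intro: reach_trans)

lemma reach_restrict:
  assumes "reach E x y" "x \<in> S" "\<And>a b. a \<in> S \<Longrightarrow> {a, b} \<in> E \<Longrightarrow> b \<in> S"
  shows "reach {e \<in> E. e \<subseteq> S} x y"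
proof -
  have "y \<in> S \<and> reach {e \<in> E. e \<subseteq> S} x y"
    using assms(1)
  proof (induction rule: reach_induct)
    case (step y z)
    with assms(3) have "z \<in> S" "reach {e \<in> E. e \<subseteq> S} y z"
      by (auto intro!: reach_edge)
    then show ?case using step by (auto intro: reach_trans)
  qed (simp add: assms(2))
  then show ?thesis ..
qed

text \<open>After the last passage through the deleted edge a walk continues from one of its
  ends.\<close>

lemma reach_remove_edge:
  assumes "reach E u w"
  shows "reach (E - {{u, v}}) u w \<or> reach (E - {{u, v}}) v w"
  using assms
proof (induction rule: reach_induct)
  case (step y z)
  show ?case
  proof (cases "{y, z} = {u, v}")
    case True
    then show ?thesis by (auto simp: doubleton_eq_iff)
  next
    case False
    then have "reach (E - {{u, v}}) y z" using step by (intro reach_edge) auto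
    then show ?thesis using step(3) by (meson reach_trans)
  qed
qed simp

text \<open>The path grows backwards from \<open>y\<close>; if the new first vertex already occurs
  on it, everything before that occurrence is cut off.\<close>

lemma reach_distinct_path:
  assumes "reach E x y"
  shows "\<exists>vs. distinct (x # vs) \<and> last (x # vs) = y \<and> successively (\<lambda>a b. {a, b} \<in> E) (x # vs)"
  using assms unfolding reach_def
proof (induction rule: converse_rtrancl_induct)
  case base
  then show ?case by (intro exI[of _ "[]"]) auto
next
  case (step x z)
  then obtain vs where vs: "distinct (z # vs)" "last (z # vs) = y"
    "successively (\<lambda>a b. {a, b} \<in> E) (z # vs)" by blast
  show ?case
  proof (cases "x \<in> set (z # vs)")
    case True
    then obtain as bs where "z # vs = as @ x # bs" by (meson split_list)
    then show ?thesis
      using vs by (intro exI[of _ bs]) (auto simp: successively_append_iff)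
  next
    case False
    then show ?thesis
      using vs step(1) by (intro exI[of _ "z # vs"]) auto
  qed
qed

text \<open>A graph is acyclic when each edge is a bridge. In this form the condition can be carried
  along joins, cuts and relabellings without handling vertex lists.\<close>

lemma graph_cycle_iff_not_bridge:
  assumes "simple_graph T"
  shows "(\<exists>vs. graph_cycle T vs) \<longleftrightarrow> (\<exists>u v. {u, v} \<in> edges T \<and> reach (edges T - {{u, v}}) u v)"
proof
  assume "\<exists>vs. graph_cycle T vs"
  then obtain vs where vs: "3 \<le> length vs" "distinct vs"
    "\<And>k. k < length vs \<Longrightarrow> {vs ! k, vs ! (Suc k mod length vs)} \<in> edges T"
    by (auto simp: graph_cycle_def)
  define l where "l = length vs - 1"
  have l: "length vs = Suc l" "2 \<le> l" using vs(1) by (auto simp: l_def)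
  have "reach (edges T - {{vs ! 0, vs ! l}}) (vs ! 0) (vs ! k)" if "k \<le> l" for k
    using that
  proof (induction k)
    case (Suc k)
    have "{vs ! k, vs ! Suc k} \<in> edges T"
      using vs(3)[of k] Suc.prems l by simp
    \<comment> \<open>The deleted edge is the one that closes the cycle; with
      \<open>l \<ge> 2\<close> no edge between consecutive positions coincides with it.\<close>
    moreover have "{vs ! k, vs ! Suc k} \<noteq> {vs ! 0, vs ! l}"
      using Suc.prems l vs(2) by (auto simp: doubleton_eq_iff nth_eq_iff_index_eq)
    ultimately have "reach (edges T - {{vs ! 0, vs ! l}}) (vs ! k) (vs ! Suc k)"
      by (intro reach_edge) simp
    then show ?case using Suc by (meson Suc_leD reach_trans)
  qed simp
  moreover have "{vs ! 0, vs ! l} \<in> edges T"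
    using vs(3)[of l] l by (simp add: insert_commute)
  ultimately show "\<exists>u v. {u, v} \<in> edges T \<and> reach (edges T - {{u, v}}) u v"
    by blast
next
  assume "\<exists>u v. {u, v} \<in> edges T \<and> reach (edges T - {{u, v}}) u v"
  then obtain u v where uv: "{u, v} \<in> edges T" "reach (edges T - {{u, v}}) u v" by blast
  obtain ws where ws: "distinct (u # ws)" "last (u # ws) = v"
    "successively (\<lambda>a b. {a, b} \<in> edges T - {{u, v}}) (u # ws)"
    using reach_distinct_path[OF uv(2)] by blast
  have "u \<noteq> v" using assms uv(1) by (auto simp: simple_graph_def)
  then have "ws \<noteq> []" using ws(2) by auto
  \<comment> \<open>A path of one step would be the deleted edge itself, so at least three vertices
    occur, as \<open>graph_cycle\<close> demands.\<close>
  moreover have "ws \<noteq> [w]" for w using ws by auto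
  ultimately obtain a b cs where ws_eq: "ws = a # b # cs" by (metis neq_Nil_conv)
  have "graph_cycle T (u # ws)"
    unfolding graph_cycle_def
  proof (intro conjI allI impI)
    fix k assume k: "k < length (u # ws)"
    show "{(u # ws) ! k, (u # ws) ! (Suc k mod length (u # ws))} \<in> edges T"
    proof (cases "Suc k = length (u # ws)")
      case True
      then have "(u # ws) ! k = v" using ws(2) last_conv_nth[of "u # ws"] by simp
      then show ?thesis using True uv(1) by (simp add: insert_commute)
    next
      case False
      then show ?thesis using k ws(3) by (auto simp: successively_conv_nth)
    qed
  qed (use ws(1) ws_eq in simp_all)
  then show "\<exists>vs. graph_cycle T vs" by blast
qed

section \<open>Labelled trees on a fixed vertex set, given by their edges\<close>

definition trees_on :: "'v set \<Rightarrow> 'v set set set" where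
  "trees_on V = {E. is_tree (V, E)}"

lemma trees_on_iff:
  "E \<in> trees_on V \<longleftrightarrow> finite V \<and> V \<noteq> {} \<and> (\<forall>e\<in>E. e \<subseteq> V \<and> card e = 2) \<and>
     (\<forall>u\<in>V. \<forall>v\<in>V. reach E u v) \<and> (\<forall>u v. {u, v} \<in> E \<longrightarrow> \<not> reach (E - {{u, v}}) u v)"
  using graph_cycle_iff_not_bridge[of "(V, E)"]
  by (auto simp: trees_on_def is_tree_def simple_graph_def connected_graph_def reach_def)

lemma
  assumes "E \<in> trees_on V"
  shows trees_on_finite: "finite V"
    and trees_on_edge_subset: "e \<in> E \<Longrightarrow> e \<subseteq> V"
    and trees_on_edge_card: "e \<in> E \<Longrightarrow> card e = 2"
    and trees_on_reach: "x \<in> V \<Longrightarrow> y \<in> V \<Longrightarrow> reach E x y"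
    and trees_on_bridge: "{x, y} \<in> E \<Longrightarrow> \<not> reach (E - {{x, y}}) x y"
  using assms unfolding trees_on_iff by blast+

lemma trees_on_empty [simp]: "trees_on {} = {}"
  by (auto simp: trees_on_iff)

lemma finite_trees_on:
  assumes "finite V"
  shows "finite (trees_on V)"
proof (rule finite_subset)
  show "trees_on V \<subseteq> Pow (Pow V)" using trees_on_edge_subset by blast
qed (use assms in simp)

lemma finite_edges_of_tree:
  assumes "E \<in> trees_on V"
  shows "finite E"
proof (rule finite_subset)
  show "E \<subseteq> Pow V" using trees_on_edge_subset[OF assms] by blast
qed (simp add: trees_on_finite[OF assms])

lemma trees_on_edge:
  assumes "E \<in> trees_on V" "{u, v} \<in> E"
  shows "u \<in> V" "v \<in> V"
  using trees_on_edge_subset[OF assms] by auto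

text \<open>The new edge is a bridge because no other edge leaves \<open>S\<close>. An old edge of
  \<open>E1\<close> remains one because collapsing \<open>S'\<close> to \<open>u\<close> maps a path
  that avoids it into \<open>E1\<close>; symmetrically for \<open>E2\<close>, with \<open>S\<close>
  collapsed to \<open>v\<close>.\<close>

lemma trees_on_join:
  assumes E1: "E1 \<in> trees_on S" and E2: "E2 \<in> trees_on S'" and disj: "S \<inter> S' = {}"
    and u: "u \<in> S" and v: "v \<in> S'"
  shows "insert {u, v} (E1 \<union> E2) \<in> trees_on (S \<union> S')"
proof -
  let ?E = "insert {u, v} (E1 \<union> E2)"
  note e1 = trees_on_edge_subset[OF E1] trees_on_edge_card[OF E1]
  note e2 = trees_on_edge_subset[OF E2] trees_on_edge_card[OF E2]
  have uv: "u \<noteq> v" using u v disj by auto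
  have r1: "reach ?E u w" if "w \<in> S" for w
    using trees_on_reach[OF E1 u that] by (rule reach_mono) auto
  have r2: "reach ?E u w" if "w \<in> S'" for w
  proof -
    have "reach ?E v w" using trees_on_reach[OF E2 v that] by (rule reach_mono) auto
    moreover have "reach ?E u v" by (intro reach_edge) simp
    ultimately show ?thesis by (meson reach_trans)
  qed
  have conn: "reach ?E x y" if "x \<in> S \<union> S'" "y \<in> S \<union> S'" for x y
    using that r1 r2 by (meson Un_iff reach_sym reach_trans)
  have bridge: "\<not> reach (?E - {{x, y}}) x y" if xy: "{x, y} \<in> ?E" for x y
  proof
    assume r: "reach (?E - {{x, y}}) x y"
    consider "{x, y} = {u, v}" | "{x, y} \<in> E1" | "{x, y} \<in> E2" using xy by blast
    then show False
    proof cases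
      case 1
      have "v \<in> S"
      proof (rule reach_closed)
        show "reach (?E - {{u, v}}) u v"
          using r 1 reach_sym[of "?E - {{u, v}}" x y] by (auto simp: doubleton_eq_iff)
        show "b \<in> S" if "a \<in> S" "{a, b} \<in> ?E - {{u, v}}" for a b
          using that e1 e2 disj by blast
      qed (rule u)
      then show False using v disj by auto
    next
      case 2
      define f where "f a = (if a \<in> S then a else u)" for a
      have "reach (E1 - {{x, y}}) (f x) (f y)"
        using r
      proof (rule reach_map)
        fix a b assume ab: "{a, b} \<in> ?E - {{x, y}}"
        then consider "{a, b} = {u, v}" | "{a, b} \<in> E1 - {{x, y}}" | "{a, b} \<in> E2" by blast
        then show "reach (E1 - {{x, y}}) (f a) (f b)"
        proof cases
          case 1
          then show ?thesis using u v disj by (auto simp: f_def doubleton_eq_iff)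
        next
          case 2
          then have "a \<in> S" "b \<in> S" using e1(1)[of "{a, b}"] by auto
          then show ?thesis using reach_edge[OF 2] by (simp add: f_def)
        next
          case 3
          then have "a \<notin> S" "b \<notin> S" using e2(1)[of "{a, b}"] disj by auto
          then show ?thesis by (simp add: f_def)
        qed
      qed
      moreover have "x \<in> S" "y \<in> S" using e1[OF 2] by auto
      ultimately show False using trees_on_bridge[OF E1 2] by (simp add: f_def)
    next
      case 3
      define f where "f a = (if a \<in> S' then a else v)" for a
      have "reach (E2 - {{x, y}}) (f x) (f y)"
        using r
      proof (rule reach_map)
        fix a b assume ab: "{a, b} \<in> ?E - {{x, y}}"
        then consider "{a, b} = {u, v}" | "{a, b} \<in> E2 - {{x, y}}" | "{a, b} \<in> E1" by blast
        then show "reach (E2 - {{x, y}}) (f a) (f b)"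
        proof cases
          case 1
          then show ?thesis using u v disj by (auto simp: f_def doubleton_eq_iff)
        next
          case 2
          then have "a \<in> S'" "b \<in> S'" using e2(1)[of "{a, b}"] by auto
          then show ?thesis using reach_edge[OF 2] by (simp add: f_def)
        next
          case 3
          then have "a \<notin> S'" "b \<notin> S'" using e1(1)[of "{a, b}"] disj by auto
          then show ?thesis by (simp add: f_def)
        qed
      qed
      moreover have "x \<in> S'" "y \<in> S'" using e2[OF 3] by auto
      ultimately show False using trees_on_bridge[OF E2 3] by (simp add: f_def)
    qed
  qed
  show ?thesis
    unfolding trees_on_iff
  proof (intro conjI)
    show "finite (S \<union> S')" "S \<union> S' \<noteq> {}"
      using trees_on_finite[OF E1] trees_on_finite[OF E2] u by auto
    show "\<forall>e\<in>?E. e \<subseteq> S \<union> S' \<and> card e = 2"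
      using e1 e2 u v uv by auto
  qed (use conn bridge in auto)
qed

text \<open>The component of \<open>u\<close> after deletion of the edge. It recovers the first
  vertex set from a tree with a marked oriented edge.\<close>

definition side :: "'v set set \<Rightarrow> 'v \<Rightarrow> 'v \<Rightarrow> 'v set" where
  "side E u v = {w. reach (E - {{u, v}}) u w}"

text \<open>The converse of \<open>trees_on_join\<close>. The edge is a bridge, so \<open>v\<close>
  falls outside \<open>S\<close>; what \<open>u\<close> no longer reaches is still reached from
  \<open>v\<close>, so both parts are connected. Bridges survive the passage to fewer edges.\<close>

lemma trees_on_split:
  assumes E: "E \<in> trees_on V" and uv: "{u, v} \<in> E"
  defines "S \<equiv> side E u v"
  shows "u \<in> S" "v \<in> V - S" "S \<subseteq> V"
    "{e \<in> E. e \<subseteq> S} \<in> trees_on S" "{e \<in> E. e \<subseteq> V - S} \<in> trees_on (V - S)"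
    "insert {u, v} ({e \<in> E. e \<subseteq> S} \<union> {e \<in> E. e \<subseteq> V - S}) = E"
proof -
  let ?E = "E - {{u, v}}"
  note sub = trees_on_edge_subset[OF E] trees_on_edge_card[OF E]
  show u: "u \<in> S" by (simp add: S_def side_def)
  have V: "u \<in> V" "v \<in> V" using trees_on_edge[OF E uv] by auto
  show v: "v \<in> V - S"
    using trees_on_bridge[OF E uv] V by (simp add: S_def side_def)
  have closed: "b \<in> S" if "a \<in> S" "{a, b} \<in> ?E" for a b
    using that unfolding S_def side_def by (auto intro: reach_trans reach_edge)
  have closed': "b \<in> V - S" if "a \<in> V - S" "{a, b} \<in> ?E" for a b
    using that closed[of b a] sub by (auto simp: insert_commute)
  show SV: "S \<subseteq> V"
  proof
    fix w assume "w \<in> S"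
    then have "reach ?E u w" by (simp add: S_def side_def)
    then show "w \<in> V" by (rule reach_closed[OF _ V(1)]) (use sub in auto)
  qed
  have E1: "{e \<in> E. e \<subseteq> S} = {e \<in> ?E. e \<subseteq> S}" using v by auto
  have E2: "{e \<in> E. e \<subseteq> V - S} = {e \<in> ?E. e \<subseteq> V - S}" using u by auto
  have bridge: "\<not> reach ({e \<in> E. Q e} - {{x, y}}) x y" if "{x, y} \<in> E" for x y and Q :: "'a set \<Rightarrow> bool"
  proof
    assume "reach ({e \<in> E. Q e} - {{x, y}}) x y"
    then have "reach (E - {{x, y}}) x y" by (rule reach_mono) auto
    then show False using trees_on_bridge[OF E that] by simp
  qed
  note fin = trees_on_finite[OF E]
  have r1: "reach {e \<in> E. e \<subseteq> S} u w" if "w \<in> S" for w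
    unfolding E1 using that closed u by (intro reach_restrict) (auto simp: S_def side_def)
  have r2: "reach {e \<in> E. e \<subseteq> V - S} v w" if "w \<in> V - S" for w
  proof -
    have "reach E u w" using trees_on_reach[OF E V(1)] that by simp
    then have "reach ?E v w" using reach_remove_edge[of E u w v] that by (auto simp: S_def side_def)
    then show ?thesis unfolding E2 by (rule reach_restrict[OF _ v closed'])
  qed
  show "{e \<in> E. e \<subseteq> S} \<in> trees_on S"
    unfolding trees_on_iff
  proof (intro conjI)
    show "\<forall>x\<in>S. \<forall>y\<in>S. reach {e \<in> E. e \<subseteq> S} x y"
      using r1 by (meson reach_sym reach_trans)
    show "finite S" using SV fin by (rule finite_subset)
    show "\<forall>x y. {x, y} \<in> {e \<in> E. e \<subseteq> S} \<longrightarrow> \<not> reach ({e \<in> E. e \<subseteq> S} - {{x, y}}) x y"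
      by (intro allI impI bridge[where Q = "\<lambda>e. e \<subseteq> S"]) simp
  qed (use u sub in auto)
  show "{e \<in> E. e \<subseteq> V - S} \<in> trees_on (V - S)"
    unfolding trees_on_iff
  proof (intro conjI)
    show "\<forall>x\<in>V - S. \<forall>y\<in>V - S. reach {e \<in> E. e \<subseteq> V - S} x y"
      using r2 by (meson reach_sym reach_trans)
    show "\<forall>x y. {x, y} \<in> {e \<in> E. e \<subseteq> V - S} \<longrightarrow>
        \<not> reach ({e \<in> E. e \<subseteq> V - S} - {{x, y}}) x y"
      by (intro allI impI bridge[where Q = "\<lambda>e. e \<subseteq> V - S"]) simp
  qed (use fin v sub in auto)
  have "e = {u, v} \<or> e \<subseteq> S \<or> e \<subseteq> V - S" if eE: "e \<in> E" for e
  proof -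
    obtain a b where e: "e = {a, b}" using sub(2)[OF eE] by (auto simp: card_2_iff)
    show ?thesis
      using closed[of a b] closed'[of a b] eE sub(1)[OF eE] unfolding e by auto
  qed
  then show "insert {u, v} ({e \<in> E. e \<subseteq> S} \<union> {e \<in> E. e \<subseteq> V - S}) = E"
    using uv by auto
qed

text \<open>Cutting undoes joining. An edge is non-empty and so cannot lie in both of the disjoint
  sets \<open>S\<close> and \<open>S'\<close>, which is why the two parts can be read off from the
  union.\<close>

lemma trees_on_join_side:
  assumes E1: "E1 \<in> trees_on S" and E2: "E2 \<in> trees_on S'" and disj: "S \<inter> S' = {}"
    and u: "u \<in> S" and v: "v \<in> S'"
  defines "E \<equiv> insert {u, v} (E1 \<union> E2)"
  shows "side E u v = S" "{e \<in> E. e \<subseteq> S} = E1" "{e \<in> E. e \<subseteq> S'} = E2" "{u, v} \<notin> E1 \<union> E2" "E1 \<inter> E2 = {}"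
proof -
  note e1 = trees_on_edge_subset[OF E1] trees_on_edge_card[OF E1]
  note e2 = trees_on_edge_subset[OF E2] trees_on_edge_card[OF E2]
  have n1: "\<not> e \<subseteq> S'" if "e \<in> E1" for e
    using e1[OF that] disj by (metis Int_absorb1 Int_greatest card.empty subset_empty zero_neq_numeral)
  have n2: "\<not> e \<subseteq> S" if "e \<in> E2" for e
    using e2[OF that] disj by (metis Int_greatest card.empty subset_empty zero_neq_numeral)
  have uv: "u \<notin> S'" "v \<notin> S" using u v disj by auto
  show nin: "{u, v} \<notin> E1 \<union> E2" using uv e1 e2 by blast
  show "{e \<in> E. e \<subseteq> S} = E1" "{e \<in> E. e \<subseteq> S'} = E2"
    using e1 e2 n1 n2 uv by (auto simp: E_def)
  show "E1 \<inter> E2 = {}" using e1 n2 by blast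
  have eq: "E - {{u, v}} = E1 \<union> E2" using nin by (auto simp: E_def)
  show "side E u v = S"
  proof
    show "side E u v \<subseteq> S"
    proof
      fix w assume "w \<in> side E u v"
      then have "reach (E1 \<union> E2) u w" by (simp add: side_def eq)
      then show "w \<in> S" by (rule reach_closed[OF _ u]) (use e1 e2 disj in blast)
    qed
    show "S \<subseteq> side E u v"
      unfolding side_def eq using reach_mono[OF trees_on_reach[OF E1 u], of _ "E1 \<union> E2"] by blast
  qed
qed

text \<open>A dart is an oriented edge, so every edge occurs twice; this matches the ordered pairs
  of rooted trees in \<open>tree_pairs\<close>.\<close>

definition tree_darts :: "'v set \<Rightarrow> ('v set set \<times> 'v \<times> 'v) set" where
  "tree_darts V = {(E, u, v). E \<in> trees_on V \<and> {u, v} \<in> E}"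

definition tree_pairs :: "'v set \<Rightarrow> ('v set \<times> 'v set set \<times> 'v set set \<times> 'v \<times> 'v) set" where
  "tree_pairs V = (SIGMA S : Pow V. trees_on S \<times> trees_on (V - S) \<times> S \<times> (V - S))"

lemma sum_tree_darts:
  "(\<Sum>(E, u, v)\<in>tree_darts V. f E) = (\<Sum>(S, E1, E2, u, v)\<in>tree_pairs V. f (insert {u, v} (E1 \<union> E2)))"
proof (rule sum.reindex_bij_witness[where
    i = "\<lambda>(S, E1, E2, u, v). (insert {u, v} (E1 \<union> E2), u, v)" and
    j = "\<lambda>(E, u, v). (side E u v, {e \<in> E. e \<subseteq> side E u v}, {e \<in> E. e \<subseteq> V - side E u v}, u, v)"], goal_cases)
  case (1 x)
  then obtain E u v where "x = (E, u, v)" "E \<in> trees_on V" "{u, v} \<in> E"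
    by (auto simp: tree_darts_def)
  then show ?case using trees_on_split(6)[of E V u v] by simp
next
  case (2 x)
  then obtain E u v where "x = (E, u, v)" "E \<in> trees_on V" "{u, v} \<in> E"
    by (auto simp: tree_darts_def)
  then show ?case using trees_on_split[of E V u v] by (simp add: tree_pairs_def)
next
  case (3 x)
  then obtain S E1 E2 u v where x: "x = (S, E1, E2, u, v)" "S \<subseteq> V" "E1 \<in> trees_on S"
    "E2 \<in> trees_on (V - S)" "u \<in> S" "v \<in> V - S"
    by (auto simp: tree_pairs_def)
  show ?case
    using trees_on_join_side[OF x(3,4) _ x(5,6)] by (simp add: x(1))
next
  case (4 x)
  then obtain S E1 E2 u v where x: "x = (S, E1, E2, u, v)" "S \<subseteq> V" "E1 \<in> trees_on S"
    "E2 \<in> trees_on (V - S)" "u \<in> S" "v \<in> V - S"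
    by (auto simp: tree_pairs_def)
  have "S \<union> (V - S) = V" using x(2) by auto
  then show ?case
    using trees_on_join[OF x(3,4) _ x(5,6)] by (simp add: x(1) tree_darts_def)
next
  case (5 x)
  then obtain E u v where "x = (E, u, v)" "E \<in> trees_on V" "{u, v} \<in> E"
    by (auto simp: tree_darts_def)
  then show ?case using trees_on_split(6)[of E V u v] by simp
qed

lemma card_edges_of_tree:
  assumes "E \<in> trees_on V"
  shows "Suc (card E) = card V"
  using assms
proof (induction "card V" arbitrary: V E rule: less_induct)
  case less
  have V: "finite V" "V \<noteq> {}" using less.prems by (auto simp: trees_on_iff)
  show ?case
  proof (cases "E = {}")
    case True
    obtain x where "x \<in> V" using V by auto
    moreover have "y = x" if "y \<in> V" for y
    proof -
      have "reach {} x y" using trees_on_reach[OF less.prems \<open>x \<in> V\<close> that] True by simp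
      then show ?thesis by (simp add: reach_def)
    qed
    ultimately have "V = {x}" by blast
    then show ?thesis using True by simp
  next
    case False
    then obtain e where "e \<in> E" by auto
    moreover have "card e = 2" using trees_on_edge_card[OF less.prems \<open>e \<in> E\<close>] .
    ultimately obtain u v where uv: "{u, v} \<in> E" by (auto simp: card_2_iff)
    \<comment> \<open>Cutting leaves two smaller trees, on \<open>a\<close> and \<open>b\<close>
      vertices say, and the edge count is \<open>(a - 1) + (b - 1) + 1\<close>.\<close>
    define S where "S = side E u v"
    note split = trees_on_split[OF less.prems uv, folded S_def]
    have fS: "finite S" using V(1) split(3) by (rule finite_subset[rotated])
    have c: "card V = card S + card (V - S)"
      using split(3) V(1) fS by (simp add: card_Diff_subset card_mono)
    have pos: "card S > 0" "card (V - S) > 0"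
      using split(1,2) fS V(1) by (auto simp: card_gt_0_iff)
    let ?E1 = "{e \<in> E. e \<subseteq> S}" and ?E2 = "{e \<in> E. e \<subseteq> V - S}"
    have "card E = card (insert {u, v} (?E1 \<union> ?E2))"
      using split(6) by simp
    also have "\<dots> = Suc (card ?E1 + card ?E2)"
      using trees_on_join_side(4,5)[OF split(4,5) _ split(1,2)] finite_edges_of_tree[OF less.prems]
      by (simp add: card_Un_disjoint)
    finally show ?thesis
      using less.hyps[OF _ split(4)] less.hyps[OF _ split(5)] c pos by simp
  qed
qed

lemma trees_on_singleton: "trees_on {v} = {{}}"
proof -
  have "E = {}" if "E \<in> trees_on {v}" for E
    using card_edges_of_tree[OF that] finite_edges_of_tree[OF that] by simp
  moreover have "{} \<in> trees_on {v}" by (simp add: trees_on_iff)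
  ultimately show ?thesis by auto
qed

lemma sum_card_adj:
  assumes "E \<in> trees_on V"
  shows "(\<Sum>v\<in>V. card (adj (V, E) v)) = 2 * card E"
proof -
  note fin = trees_on_finite[OF assms] finite_edges_of_tree[OF assms]
  have "(\<Sum>v\<in>V. card (adj (V, E) v)) = (\<Sum>v\<in>V. \<Sum>e\<in>E. if v \<in> e then 1 else 0)"
    using fin by (simp add: adj_def sum.If_cases Int_def)
  also have "\<dots> = (\<Sum>e\<in>E. \<Sum>v\<in>V. if v \<in> e then 1 else 0)"
    by (rule sum.swap)
  also have "\<dots> = (\<Sum>e\<in>E. 2)"
  proof (rule sum.cong)
    fix e assume "e \<in> E"
    then have "e \<subseteq> V" "card e = 2" using trees_on_edge_subset[OF assms] trees_on_edge_card[OF assms] by auto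
    then have "V \<inter> {v. v \<in> e} = e" by auto
    then show "(\<Sum>v\<in>V. if v \<in> e then 1 else 0) = (2::nat)"
      using fin \<open>card e = 2\<close> by (simp add: sum.If_cases)
  qed simp
  finally show ?thesis by simp
qed

text \<open>A dart amounts to its tail together with its edge, so darts are counted by the sum of
  the valencies.\<close>

lemma card_darts:
  assumes "E \<in> trees_on V"
  shows "card {(u, v). {u, v} \<in> E} = 2 * card E"
proof -
  note fin = trees_on_finite[OF assms] finite_edges_of_tree[OF assms]
  have "bij_betw (\<lambda>(u, v). (u, {u, v})) {(u, v). {u, v} \<in> E} (SIGMA u : V. adj (V, E) u)"
    unfolding bij_betw_def
  proof
    show "inj_on (\<lambda>(u, v). (u, {u, v})) {(u, v). {u, v} \<in> E}"
      by (auto simp: inj_on_def doubleton_eq_iff)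
    show "(\<lambda>(u, v). (u, {u, v})) ` {(u, v). {u, v} \<in> E} = (SIGMA u : V. adj (V, E) u)"
    proof safe
      fix u e assume "u \<in> V" "e \<in> adj (V, E) u"
      then have "e \<in> E" "u \<in> e" "card e = 2" using trees_on_edge_card[OF assms] by (auto simp: adj_def)
      then obtain v where "e = {u, v}" by (auto simp: card_2_iff)
      then show "(u, e) \<in> (\<lambda>(u, v). (u, {u, v})) ` {(u, v). {u, v} \<in> E}"
        using \<open>e \<in> E\<close> by auto
    qed (use trees_on_edge[OF assms] in \<open>auto simp: adj_def\<close>)
  qed
  then have "card {(u, v). {u, v} \<in> E} = (\<Sum>u\<in>V. card (adj (V, E) u))"
    using fin by (simp add: bij_betw_same_card adj_def)
  then show ?thesis using sum_card_adj[OF assms] by simp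
qed

section \<open>Tree series\<close>

lemma D_edges_cong:
  assumes "finite A" "\<And>e. e \<in> A \<Longrightarrow> l e = l' e"
  shows "D_edges l A P = D_edges l' A P"
  using assms by (induction A) auto

lemma D_edges_image:
  assumes "finite A" "inj_on g A"
  shows "D_edges l (g ` A) P = D_edges (\<lambda>e. l (g e)) A P"
  using assms by (induction A) auto

text \<open>The first derivative has order two and each further one costs at most one degree. For
  empty \<open>A\<close> the bound can fail, since \<open>P\<close> may have a constant
  term.\<close>

lemma mps_ord_ge_D_edges:
  assumes P: "\<And>i. mps_ord_ge (mps_deriv i P) 2" and A: "finite A" "A \<noteq> {}"
  shows "mps_ord_ge (D_edges l A P) (3 - card A)"
  using A
proof (induction rule: finite_ne_induct)
  case (singleton e)
  then show ?case using P[of "l e"] by simp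
next
  case (insert e A)
  then show ?case using mps_ord_ge_deriv[OF insert.IH, of "l e"] by simp
qed

lemma finite_adj: "E \<in> trees_on V \<Longrightarrow> finite (adj (V, E) v)"
  by (simp add: adj_def finite_edges_of_tree)

lemma adj_nonempty:
  assumes E: "E \<in> trees_on V" and V: "2 \<le> card V" and v: "v \<in> V"
  shows "adj (V, E) v \<noteq> {}"
proof
  assume adj: "adj (V, E) v = {}"
  have "w = v" if "w \<in> V" for w
  proof -
    have "w \<in> {v}"
      by (rule reach_closed[OF trees_on_reach[OF E v that]]) (use adj in \<open>auto simp: adj_def\<close>)
    then show ?thesis by simp
  qed
  then have "V \<subseteq> {v}" by blast
  then have "card V \<le> card {v}" by (intro card_mono) simp_all
  then show False using V by simp
qed

text \<open>A vertex contributes at least three minus its valency, and the valencies add up to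
  \<open>2 (n - 1)\<close>, which leaves \<open>3 n - 2 (n - 1) = n + 2\<close>. Truncated
  subtraction only helps here. Two vertices are required so that every valency is positive.\<close>

lemma mps_ord_ge_tree_series:
  assumes P: "\<And>i. mps_ord_ge (mps_deriv i P) 2" and E: "E \<in> trees_on V" and V: "2 \<le> card V"
  shows "mps_ord_ge (tree_series (V, E) P) (card V + 2)"
proof -
  have "3 * card V = (\<Sum>v\<in>V. 3)" by simp
  also have "\<dots> \<le> (\<Sum>v\<in>V. (3 - card (adj (V, E) v)) + card (adj (V, E) v))"
    by (rule sum_mono) simp
  also have "\<dots> = (\<Sum>v\<in>V. 3 - card (adj (V, E) v)) + 2 * card E"
    by (simp only: sum.distrib sum_card_adj[OF E])
  finally have "card V + 2 \<le> (\<Sum>v\<in>V. 3 - card (adj (V, E) v))"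
    using card_edges_of_tree[OF E] by simp
  moreover have "mps_ord_ge (\<Prod>v\<in>V. D_edges l (adj (V, E) v) P) (\<Sum>v\<in>V. 3 - card (adj (V, E) v))" for l
    by (intro mps_ord_ge_prod mps_ord_ge_D_edges P finite_adj[OF E] adj_nonempty[OF E V])
  ultimately show ?thesis
    unfolding tree_series_def by (auto intro!: mps_ord_ge_sum intro: mps_ord_ge_mono)
qed

lemma tree_series_image:
  assumes E: "E \<in> trees_on V" and f: "inj_on f V"
  shows "tree_series (f ` V, (`) f ` E) P = tree_series (V, E) P"
proof -
  have EV: "E \<subseteq> Pow V" using trees_on_edge_subset[OF E] by blast
  have inj: "inj_on ((`) f) E" using inj_on_image_Pow[OF f] EV by (rule inj_on_subset)
  have adj: "adj (f ` V, (`) f ` E) (f v) = (`) f ` adj (V, E) v" if "v \<in> V" for v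
  proof -
    have "f v \<in> f ` e \<longleftrightarrow> v \<in> e" if "e \<in> E" for e
      using EV f that \<open>v \<in> V\<close> by (blast dest: inj_onD)
    then show ?thesis by (auto simp: adj_def)
  qed
  have D: "D_edges l (adj (f ` V, (`) f ` E) (f v)) P = D_edges (restrict (\<lambda>e. l (f ` e)) E) (adj (V, E) v) P"
    if "v \<in> V" for v l
  proof -
    have "D_edges l ((`) f ` adj (V, E) v) P = D_edges (\<lambda>e. l (f ` e)) (adj (V, E) v) P"
      by (rule D_edges_image[OF finite_adj[OF E]])
        (rule inj_on_subset[OF inj], simp add: adj_def)
    also have "\<dots> = D_edges (restrict (\<lambda>e. l (f ` e)) E) (adj (V, E) v) P"
      by (rule D_edges_cong[OF finite_adj[OF E]]) (simp add: adj_def)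
    finally show ?thesis using adj[OF that] by simp
  qed
  show ?thesis
    unfolding tree_series_def fst_conv snd_conv
  \<comment> \<open>Labellings correspond through the action of \<open>f\<close> on edges;
    \<open>restrict\<close> resets them to \<open>undefined\<close> off the edge set, as the
    extensional function space demands.\<close>
  proof (rule sum.reindex_bij_witness[where
        j = "\<lambda>l. restrict (\<lambda>e. l (f ` e)) E" and
        i = "\<lambda>l. restrict (\<lambda>e'. l (inv_into E ((`) f) e')) ((`) f ` E)"], goal_cases)
    case (1 l)
    show ?case
    proof
      fix e' show "restrict (\<lambda>e'. restrict (\<lambda>e. l (f ` e)) E (inv_into E ((`) f) e')) ((`) f ` E) e' = l e'"
      proof (cases "e' \<in> (`) f ` E")
        case True
        then have "f ` inv_into E ((`) f) e' = e'" "inv_into E ((`) f) e' \<in> E"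
          by (rule f_inv_into_f, rule inv_into_into)
        then show ?thesis using True by (simp only: restrict_apply if_True)
      next
        case False
        then show ?thesis using PiE_arb[OF 1 False] by (simp only: restrict_apply if_False)
      qed
    qed
  next
    case (3 l)
    show ?case
    proof
      fix e show "restrict (\<lambda>e. restrict (\<lambda>e'. l (inv_into E ((`) f) e')) ((`) f ` E) (f ` e)) E e = l e"
      proof (cases "e \<in> E")
        case True
        then have "inv_into E ((`) f) (f ` e) = e" "f ` e \<in> (`) f ` E"
          using inv_into_f_f[OF inj] by blast+
        then show ?thesis using True by (simp only: restrict_apply if_True)
      next
        case False
        then show ?thesis using PiE_arb[OF 3 False] by (simp only: restrict_apply if_False)
      qed
    qed
  next
    case (5 l)
    show ?case
      by (simp add: prod.reindex[OF f] D)
  qed auto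
qed

text \<open>The series of a tree with root \<open>u\<close> to which a half-edge labelled
  \<open>j\<close> is attached: \<open>mps_deriv j\<close> is the contribution of the
  half-edge.\<close>

definition rooted_series ::
    "'v set \<Rightarrow> 'v set set \<Rightarrow> 'v \<Rightarrow> 'n \<Rightarrow> ('a::comm_ring_1, 'n::finite) mps \<Rightarrow> ('a, 'n) mps" where
  "rooted_series V E u j P = (\<Sum>l\<in>E \<rightarrow>\<^sub>E UNIV.
     mps_deriv j (D_edges l (adj (V, E) u) P) * (\<Prod>v\<in>V - {u}. D_edges l (adj (V, E) v) P))"

text \<open>By the Leibniz rule the derivative falls on one vertex at a time, and that vertex
  becomes the root.\<close>

lemma mps_deriv_tree_series:
  assumes "finite V"
  shows "mps_deriv j (tree_series (V, E) P) = (\<Sum>u\<in>V. rooted_series V E u j P)"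
  unfolding tree_series_def rooted_series_def fst_conv snd_conv mps_deriv_sum mps_deriv_prod[OF assms]
  by (rule sum.swap)

text \<open>A labelling of a joined tree consists of a label for the joining edge and a labelling of
  each part.\<close>

lemma sum_PiE_insert_Un:
  assumes "a \<notin> A \<union> B" "A \<inter> B = {}"
  shows "(\<Sum>l\<in>insert a (A \<union> B) \<rightarrow>\<^sub>E C. f (l a) (restrict l A) (restrict l B)) =
    (\<Sum>(j, l1, l2)\<in>C \<times> (A \<rightarrow>\<^sub>E C) \<times> (B \<rightarrow>\<^sub>E C). f j l1 l2)"
proof (rule sum.reindex_bij_witness[where
      j = "\<lambda>l. (l a, restrict l A, restrict l B)" and
      i = "\<lambda>(j, l1, l2) x. if x \<in> A then l1 x else if x \<in> B then l2 x else if x = a then j else undefined"],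
    goal_cases)
  case (3 x)
  obtain j l1 l2 where x: "x = (j, l1, l2)" "l1 \<in> A \<rightarrow>\<^sub>E C" "l2 \<in> B \<rightarrow>\<^sub>E C"
    using 3 by auto
  have "restrict l1 A = l1" "restrict l2 B = l2"
    using x by (simp_all add: PiE_restrict)
  moreover have "restrict (\<lambda>x. if x \<in> A then l1 x else if x \<in> B then l2 x else if x = a then j else undefined) A = restrict l1 A"
    "restrict (\<lambda>x. if x \<in> A then l1 x else if x \<in> B then l2 x else if x = a then j else undefined) B = restrict l2 B"
    using assms by (auto intro!: restrict_ext)
  ultimately show ?case using assms x(1) by simp
qed (use assms in \<open>auto simp: PiE_iff extensional_def fun_eq_iff\<close>)

text \<open>The label \<open>j\<close> of the joining edge differentiates the factors of both
  \<open>u\<close> and \<open>v\<close>, while every other operator comes from an edge within one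
  part. For fixed \<open>j\<close> the sum over the remaining labels therefore factorises, each
  half-edge giving a rooted series.\<close>

lemma tree_series_join:
  assumes E1: "E1 \<in> trees_on S" and E2: "E2 \<in> trees_on S'" and disj: "S \<inter> S' = {}"
    and u: "u \<in> S" and v: "v \<in> S'"
  shows "tree_series (S \<union> S', insert {u, v} (E1 \<union> E2)) P =
    (\<Sum>j\<in>UNIV. rooted_series S E1 u j P * rooted_series S' E2 v j P)"
proof -
  let ?e = "{u, v}"
  let ?E = "insert ?e (E1 \<union> E2)"
  let ?r1 = "\<lambda>j l. mps_deriv j (D_edges l (adj (S, E1) u) P) * (\<Prod>w\<in>S - {u}. D_edges l (adj (S, E1) w) P)"
  let ?r2 = "\<lambda>j l. mps_deriv j (D_edges l (adj (S', E2) v) P) * (\<Prod>w\<in>S' - {v}. D_edges l (adj (S', E2) w) P)"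
  note nin = trees_on_join_side(4)[OF E1 E2 disj u v]
  note E12 = trees_on_join_side(5)[OF E1 E2 disj u v]
  have uv: "u \<notin> S'" "v \<notin> S" using u v disj by auto
  note s1 = trees_on_edge_subset[OF E1] and s2 = trees_on_edge_subset[OF E2]
  have n1: "w \<notin> e" if "w \<in> S'" "e \<in> E1" for w e using s1[of e] that disj by auto
  have n2: "w \<notin> e" if "w \<in> S" "e \<in> E2" for w e using s2[of e] that disj by auto
  have adj1: "adj (S \<union> S', ?E) w = (if w = u then insert ?e (adj (S, E1) u) else adj (S, E1) w)"
    if "w \<in> S" for w
    using that uv n2[OF that] by (auto simp: adj_def)
  have adj2: "adj (S \<union> S', ?E) w = (if w = v then insert ?e (adj (S', E2) v) else adj (S', E2) w)"
    if "w \<in> S'" for w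
    using that uv n1[OF that] by (auto simp: adj_def)
  note fin = trees_on_finite[OF E1] trees_on_finite[OF E2]
  have split: "(\<Prod>w\<in>S \<union> S'. D_edges l (adj (S \<union> S', ?E) w) P) = ?r1 (l ?e) l * ?r2 (l ?e) l" for l
  proof -
    have "(\<Prod>w\<in>S. D_edges l (adj (S \<union> S', ?E) w) P) =
        D_edges l (adj (S \<union> S', ?E) u) P * (\<Prod>w\<in>S - {u}. D_edges l (adj (S \<union> S', ?E) w) P)"
      using fin u by (simp add: prod.remove)
    also have "(\<Prod>w\<in>S - {u}. D_edges l (adj (S \<union> S', ?E) w) P) = (\<Prod>w\<in>S - {u}. D_edges l (adj (S, E1) w) P)"
      by (rule prod.cong) (simp_all add: adj1)
    also have "D_edges l (adj (S \<union> S', ?E) u) P = mps_deriv (l ?e) (D_edges l (adj (S, E1) u) P)"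
      unfolding adj1[OF u] if_P[OF refl] using nin by (intro D_edges_insert finite_adj[OF E1]) (simp add: adj_def)
    finally have p1: "(\<Prod>w\<in>S. D_edges l (adj (S \<union> S', ?E) w) P) = ?r1 (l ?e) l" .
    have "(\<Prod>w\<in>S'. D_edges l (adj (S \<union> S', ?E) w) P) =
        D_edges l (adj (S \<union> S', ?E) v) P * (\<Prod>w\<in>S' - {v}. D_edges l (adj (S \<union> S', ?E) w) P)"
      using fin v by (simp add: prod.remove)
    also have "(\<Prod>w\<in>S' - {v}. D_edges l (adj (S \<union> S', ?E) w) P) = (\<Prod>w\<in>S' - {v}. D_edges l (adj (S', E2) w) P)"
      by (rule prod.cong) (simp_all add: adj2)
    also have "D_edges l (adj (S \<union> S', ?E) v) P = mps_deriv (l ?e) (D_edges l (adj (S', E2) v) P)"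
      unfolding adj2[OF v] if_P[OF refl] using nin by (intro D_edges_insert finite_adj[OF E2]) (simp add: adj_def)
    finally have p2: "(\<Prod>w\<in>S'. D_edges l (adj (S \<union> S', ?E) w) P) = ?r2 (l ?e) l" .
    show ?thesis
      by (simp only: prod.union_disjoint[OF fin disj] p1 p2)
  qed
  have cong1: "D_edges l (adj (S, E1) w) P = D_edges l' (adj (S, E1) w) P"
    if "\<And>e. e \<in> E1 \<Longrightarrow> l e = l' e" for l l' w
    by (rule D_edges_cong[OF finite_adj[OF E1]]) (simp add: adj_def that)
  have cong2: "D_edges l (adj (S', E2) w) P = D_edges l' (adj (S', E2) w) P"
    if "\<And>e. e \<in> E2 \<Longrightarrow> l e = l' e" for l l' w
    by (rule D_edges_cong[OF finite_adj[OF E2]]) (simp add: adj_def that)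
  have "tree_series (S \<union> S', ?E) P = (\<Sum>l\<in>?E \<rightarrow>\<^sub>E UNIV. ?r1 (l ?e) l * ?r2 (l ?e) l)"
    unfolding tree_series_def fst_conv snd_conv split ..
  also have "\<dots> = (\<Sum>(j, l1, l2)\<in>UNIV \<times> (E1 \<rightarrow>\<^sub>E UNIV) \<times> (E2 \<rightarrow>\<^sub>E UNIV). ?r1 j l1 * ?r2 j l2)"
  proof -
    have c1: "D_edges (restrict l E1) (adj (S, E1) w) P = D_edges l (adj (S, E1) w) P" for l w
      by (rule cong1) simp
    have c2: "D_edges (restrict l E2) (adj (S', E2) w) P = D_edges l (adj (S', E2) w) P" for l w
      by (rule cong2) simp
    show ?thesis
      using sum_PiE_insert_Un[OF nin E12, of "\<lambda>j l1 l2. ?r1 j l1 * ?r2 j l2"]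
      by (simp only: c1 c2)
  qed
  also have "\<dots> = (\<Sum>j\<in>UNIV. rooted_series S E1 u j P * rooted_series S' E2 v j P)"
    by (simp only: sum.cartesian_product[symmetric] sum_product rooted_series_def)
  finally show ?thesis .
qed

section \<open>Sums over labelled trees\<close>

definition labelled_series :: "'v set \<Rightarrow> ('a::comm_ring_1, 'n::finite) mps \<Rightarrow> ('a, 'n) mps" where
  "labelled_series V P = (\<Sum>E\<in>trees_on V. tree_series (V, E) P)"

lemma labelled_series_empty [simp]: "labelled_series {} P = 0"
  by (simp add: labelled_series_def)

lemma mps_deriv_labelled_series:
  assumes "finite V"
  shows "mps_deriv j (labelled_series V P) = (\<Sum>E\<in>trees_on V. \<Sum>u\<in>V. rooted_series V E u j P)"
  by (simp add: labelled_series_def mps_deriv_sum mps_deriv_tree_series[OF assms])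

text \<open>
  Both sides count trees with a marked oriented edge: a tree with \<open>n\<close> vertices has \<open>2 (n - 1)\<close>
  oriented edges, and deleting the marked one leaves an ordered pair of rooted trees.
\<close>

lemma labelled_series_rec:
  assumes V: "finite V"
  shows "of_nat (2 * (card V - 1)) * labelled_series V P =
    (\<Sum>S\<in>Pow V. \<Sum>j\<in>UNIV. mps_deriv j (labelled_series S P) * mps_deriv j (labelled_series (V - S) P))"
proof -
  have "of_nat (2 * (card V - 1)) * labelled_series V P =
      (\<Sum>E\<in>trees_on V. \<Sum>(u, v)\<in>{(u, v). {u, v} \<in> E}. tree_series (V, E) P)"
    unfolding labelled_series_def sum_distrib_left
  proof (rule sum.cong)
    fix E assume E: "E \<in> trees_on V"
    have "2 * (card V - 1) = card {(u, v). {u, v} \<in> E}"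
      using card_darts[OF E] card_edges_of_tree[OF E] by simp
    then show "of_nat (2 * (card V - 1)) * tree_series (V, E) P =
        (\<Sum>(u, v)\<in>{(u, v). {u, v} \<in> E}. tree_series (V, E) P)"
      by (simp only: case_prod_conv sum_constant split_def)
  qed simp
  also have "\<dots> = (\<Sum>(E, u, v)\<in>tree_darts V. tree_series (V, E) P)"
  proof -
    have "finite {(u, v). {u, v} \<in> E}" if "E \<in> trees_on V" for E
    proof (rule finite_subset)
      show "{(u, v). {u, v} \<in> E} \<subseteq> V \<times> V" using trees_on_edge[OF that] by blast
    qed (use V in simp)
    moreover have "tree_darts V = (SIGMA E : trees_on V. {(u, v). {u, v} \<in> E})"
      by (auto simp: tree_darts_def)
    ultimately show ?thesis
      using finite_trees_on[OF V] sum.Sigma[of "trees_on V" "\<lambda>E. {(u, v). {u, v} \<in> E}"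
          "\<lambda>E (u, v). tree_series (V, E) P"] by (simp only: split_def) blast
  qed
  also have "\<dots> = (\<Sum>(S, E1, E2, u, v)\<in>tree_pairs V. tree_series (V, insert {u, v} (E1 \<union> E2)) P)"
    by (rule sum_tree_darts)
  also have "\<dots> = (\<Sum>(S, E1, E2, u, v)\<in>tree_pairs V.
      \<Sum>j\<in>UNIV. rooted_series S E1 u j P * rooted_series (V - S) E2 v j P)"
  proof (rule sum.cong)
    fix x assume "x \<in> tree_pairs V"
    then obtain S E1 E2 u v where x: "x = (S, E1, E2, u, v)" "S \<subseteq> V" "E1 \<in> trees_on S"
      "E2 \<in> trees_on (V - S)" "u \<in> S" "v \<in> V - S"
      by (auto simp: tree_pairs_def)
    have "S \<union> (V - S) = V" "S \<inter> (V - S) = {}" using x(2) by auto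
    then show "(case x of (S, E1, E2, u, v) \<Rightarrow> tree_series (V, insert {u, v} (E1 \<union> E2)) P) =
        (case x of (S, E1, E2, u, v) \<Rightarrow> \<Sum>j\<in>UNIV. rooted_series S E1 u j P * rooted_series (V - S) E2 v j P)"
      using tree_series_join[OF x(3,4) _ x(5,6), of P] by (simp add: x(1))
  qed simp
  also have "\<dots> = (\<Sum>S\<in>Pow V. \<Sum>(E1, E2, u, v)\<in>trees_on S \<times> trees_on (V - S) \<times> S \<times> (V - S).
      \<Sum>j\<in>UNIV. rooted_series S E1 u j P * rooted_series (V - S) E2 v j P)"
  proof -
    have "finite S" "finite (trees_on S)" if "S \<subseteq> V" for S
      using finite_subset[OF that V] by (auto intro: finite_trees_on)
    then show ?thesis
      unfolding tree_pairs_def using V by (subst sum.Sigma) (auto intro!: finite_cartesian_product)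
  qed
  also have "\<dots> = (\<Sum>S\<in>Pow V. \<Sum>j\<in>UNIV. mps_deriv j (labelled_series S P) * mps_deriv j (labelled_series (V - S) P))"
  proof (rule sum.cong)
    fix S assume S: "S \<in> Pow V"
    then have fin: "finite S" "finite (V - S)" using V by (auto intro: finite_subset)
    have "(\<Sum>(E1, E2, u, v)\<in>trees_on S \<times> trees_on (V - S) \<times> S \<times> (V - S).
        \<Sum>j\<in>UNIV. rooted_series S E1 u j P * rooted_series (V - S) E2 v j P) =
      (\<Sum>j\<in>UNIV. \<Sum>(E1, E2, u, v)\<in>trees_on S \<times> trees_on (V - S) \<times> S \<times> (V - S).
        rooted_series S E1 u j P * rooted_series (V - S) E2 v j P)"
      unfolding split_def by (rule sum.swap)
    also have "\<dots> = (\<Sum>j\<in>UNIV. mps_deriv j (labelled_series S P) * mps_deriv j (labelled_series (V - S) P))"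
      by (simp only: sum.cartesian_product[symmetric] mps_deriv_labelled_series[OF fin(1)]
          mps_deriv_labelled_series[OF fin(2)] sum_product)
    finally show "(\<Sum>(E1, E2, u, v)\<in>trees_on S \<times> trees_on (V - S) \<times> S \<times> (V - S).
        \<Sum>j\<in>UNIV. rooted_series S E1 u j P * rooted_series (V - S) E2 v j P) =
      (\<Sum>j\<in>UNIV. mps_deriv j (labelled_series S P) * mps_deriv j (labelled_series (V - S) P))" .
  qed simp
  finally show ?thesis .
qed

text \<open>The inverse of \<open>f\<close> pulls a path that avoids an image edge back to a path
  that avoids the edge itself, so bridges stay bridges.\<close>

lemma trees_on_image:
  assumes E: "E \<in> trees_on V" and f: "inj_on f V"
  shows "(`) f ` E \<in> trees_on (f ` V)"
proof -
  define g where "g = inv_into V f"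
  have gf: "g ` f ` e = e" if "e \<subseteq> V" for e
    using that f by (simp add: g_def inv_into_image_cancel)
  have gf1: "g (f x) = x" if "x \<in> V" for x using that f by (simp add: g_def)
  note sub = trees_on_edge_subset[OF E] and card = trees_on_edge_card[OF E]
  show ?thesis
    unfolding trees_on_iff
  proof (intro conjI ballI allI impI)
    show "finite (f ` V)" "f ` V \<noteq> {}" using E by (auto simp: trees_on_iff)
    fix e assume "e \<in> (`) f ` E"
    then obtain d where d: "d \<in> E" "e = f ` d" by auto
    show "e \<subseteq> f ` V" using sub[OF d(1)] d(2) by auto
    show "card e = 2" using card[OF d(1)] card_image[OF inj_on_subset[OF f sub[OF d(1)]]] d(2) by simp
  next
    fix x y assume "x \<in> f ` V" "y \<in> f ` V"
    then obtain a b where ab: "a \<in> V" "b \<in> V" "x = f a" "y = f b" by auto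
    show "reach ((`) f ` E) x y"
      unfolding ab(3,4) by (rule reach_map[OF trees_on_reach[OF E ab(1,2)]], rule reach_edge)
        (metis image_empty image_insert image_eqI)
  next
    fix x y assume xy: "{x, y} \<in> (`) f ` E"
    then obtain d where d: "d \<in> E" "{x, y} = f ` d" by auto
    have gd: "{g x, g y} = d" using gf[OF sub[OF d(1)]] by (metis d(2) image_empty image_insert)
    show "\<not> reach ((`) f ` E - {{x, y}}) x y"
    proof
      assume "reach ((`) f ` E - {{x, y}}) x y"
      then have "reach (E - {{g x, g y}}) (g x) (g y)"
      proof (rule reach_map)
        fix a b assume ab: "{a, b} \<in> (`) f ` E - {{x, y}}"
        then obtain c where c: "c \<in> E" "{a, b} = f ` c" by auto
        have gc: "{g a, g b} = c" using gf[OF sub[OF c(1)]] by (metis c(2) image_empty image_insert)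
        have "c \<noteq> d" using ab c d by auto
        then show "reach (E - {{g x, g y}}) (g a) (g b)"
          using c(1) by (intro reach_edge) (simp add: gc gd)
      qed
      then show False using trees_on_bridge[OF E, of "g x" "g y"] gd d(1) by simp
    qed
  qed
qed

text \<open>A bijection of the vertex sets transports trees together with their series. Sums over
  vertex subsets can therefore be grouped by cardinality.\<close>

lemma labelled_series_card:
  assumes "finite V" "finite W" "card V = card W"
  shows "labelled_series V P = labelled_series W P"
proof -
  obtain f where f: "bij_betw f V W" using assms finite_same_card_bij by blast
  then have inj: "inj_on f V" and im: "f ` V = W" by (auto simp: bij_betw_def)
  define g where "g = inv_into V f"
  have g: "inj_on g W" "g ` W = V"
    using bij_betw_inv_into[OF f] by (auto simp: bij_betw_def g_def)
  have gf: "g ` f ` e = e" if "e \<subseteq> V" for e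
    using that inj by (simp add: g_def inv_into_image_cancel)
  have fg: "f ` g ` e = e" if "e \<subseteq> W" for e
    using that im by (simp add: g_def image_inv_into_cancel)
  show ?thesis
    unfolding labelled_series_def
  proof (rule sum.reindex_bij_witness[where j = "(`) ((`) f)" and i = "(`) ((`) g)"], goal_cases)
    case (1 E)
    have "(`) g ` (`) f ` E = (\<lambda>e. g ` f ` e) ` E" by (rule image_image)
    also have "\<dots> = (\<lambda>e. e) ` E" using trees_on_edge_subset[OF 1] gf by (intro image_cong) auto
    finally show ?case by simp
  next
    case (2 E)
    then show ?case using trees_on_image[OF 2 inj] by (simp add: im)
  next
    case (3 E)
    have "(`) f ` (`) g ` E = (\<lambda>e. f ` g ` e) ` E" by (rule image_image)
    also have "\<dots> = (\<lambda>e. e) ` E" using trees_on_edge_subset[OF 3] fg by (intro image_cong) auto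
    finally show ?case by simp
  next
    case (4 E)
    then show ?case using trees_on_image[OF 4 g(1)] by (simp add: g(2))
  next
    case (5 E)
    then show ?case using tree_series_image[OF 5 inj, of P] by (simp add: im)
  qed
qed

section \<open>Characteristics of the Burgers equation\<close>

context rat_algebra
begin

lemma of_nat_mult_eq_qscale: "of_nat n * x = qscale (of_nat n) x"
  by (induction n) (simp_all add: algebra_simps)

text \<open>Rational scalars make positive integers invertible, which permits cancellation even if
  the ring has zero divisors.\<close>

lemma of_nat_Suc_mult_cancel:
  assumes "of_nat (Suc n) * x = of_nat (Suc n) * (y :: 'a)"
  shows "x = y"
  using assms unfolding of_nat_mult_eq_qscale by (simp del: of_nat_Suc)

lemma qscale_mult_right: "qscale r (x * y) = x * qscale r y"
  using qscale_mult_left[of r y x] by (simp add: mult.commute)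

lemma mps_nth_scale: "mps_nth (mps_scale qscale r f) e = qscale r (mps_nth f e)"
  by (simp add: mps_scale_def)

lemma mps_scale_sum: "mps_scale qscale r (\<Sum>x\<in>A. f x) = (\<Sum>x\<in>A. mps_scale qscale r (f x))"
  by (simp add: mps_eq_iff mps_nth_scale mps_nth_sum scale_sum_right)

lemma mps_scale_deriv: "mps_scale qscale r (mps_deriv i f) = mps_deriv i (mps_scale qscale r f)"
  by (simp add: mps_eq_iff mps_nth_scale mps_nth_deriv qscale_mult_right del: of_nat_Suc)

lemma mps_scale_mult:
  "mps_scale qscale r f * mps_scale qscale s g = mps_scale qscale (r * s) (f * g)"
proof -
  have "qscale r x * qscale s y = qscale (r * s) (x * y)" for x y
    by (simp add: qscale_mult_left[symmetric] qscale_mult_right[symmetric])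
  then show ?thesis
    by (simp add: mps_eq_iff mps_nth_scale mps_nth_mult scale_sum_right)
qed

lemma mps_scale_scale: "mps_scale qscale r (mps_scale qscale s f) = mps_scale qscale (r * s) f"
  by (simp add: mps_eq_iff mps_nth_scale)

lemma mps_scale_of_nat: "of_nat n * f = mps_scale qscale (of_nat n) f"
  by (induction n) (simp_all add: mps_eq_iff mps_nth_scale algebra_simps)

text \<open>
  Weighting \<open>q m\<close> with \<open>s ^ m\<close> turns the recurrence into the Burgers equation for \<open>U = \<nabla>Q\<^sub>s\<close>.
  Along \<open>F\<^sub>s = X - s \<nabla>P\<close> the defect \<open>W = U(F\<^sub>s) - \<nabla>P\<close> then solves a homogeneous linear
  differential equation in \<open>s\<close> and vanishes at \<open>s = 0\<close>.
  Coefficients are polynomials in \<open>s\<close>, so that \<open>s = 1\<close> may be substituted.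
\<close>

lemma compose_gradient_of_burgers_solution:
  fixes P :: "('a, 'n::finite) mps" and q :: "nat \<Rightarrow> ('a, 'n) mps"
  assumes P: "\<And>i. mps_ord_ge (mps_deriv i P) 2"
    and q0: "q 0 = P"
    and q_Suc: "\<And>m. of_nat (2 * Suc m) * q (Suc m) =
      (\<Sum>k\<le>m. \<Sum>j\<in>UNIV. mps_deriv j (q k) * mps_deriv j (q (m - k)))"
    and q_ord: "\<And>m. mps_ord_ge (q m) m"
  defines "Q \<equiv> Abs_mps (\<lambda>e. \<Sum>m\<le>mdeg e. mps_nth (q m) e)"
  shows "mps_compose (mps_deriv i Q) (\<lambda>i. mps_X i - mps_deriv i P) = mps_deriv i P"
proof -
  \<comment> \<open>By \<open>q_ord\<close> the terms beyond \<open>mdeg e\<close> vanish, so the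
    cut-off loses nothing and keeps each coefficient polynomial in \<open>s\<close>.\<close>
  define Qs :: "('a poly, 'n) mps" where
    "Qs = Abs_mps (\<lambda>e. \<Sum>m\<le>mdeg e. monom (mps_nth (q m) e) m)"
  define U where "U i = mps_deriv i Qs" for i
  \<comment> \<open>\<open>monom x 1\<close> is \<open>x\<close> times the weight \<open>s\<close>,
    and \<open>[:x:]\<close> is \<open>x\<close> as a constant; \<open>F\<close> runs from the
    identity at \<open>s = 0\<close> to the given map at \<open>s = 1\<close>.\<close>
  define F where "F i = mps_X i - mps_map (\<lambda>x. monom x 1) (mps_deriv i P)" for i
  define W where "W i = mps_compose (U i) F - mps_map (\<lambda>x. [:x:]) (mps_deriv i P)" for i
  define A where "A i j = mps_compose (mps_deriv j (U i)) F" for i j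
  have Qs: "coeff (mps_nth Qs e) m = mps_nth (q m) e" for e m
  proof -
    have "coeff (mps_nth Qs e) m = (\<Sum>k\<le>mdeg e. if k = m then mps_nth (q m) e else 0)"
      by (auto simp: Qs_def coeff_sum intro!: sum.cong)
    also have "\<dots> = mps_nth (q m) e"
      using mps_ord_geD[OF q_ord, of e m] by auto
    finally show ?thesis .
  qed
  have Q_eq: "mps_map (\<lambda>p. poly p 1) Qs = Q"
    by (rule mps_ext) (simp add: Qs_def Q_def poly_sum poly_monom)
  have coeff_U: "coeff (mps_nth (U j) e) m = mps_nth (mps_deriv j (q m)) e" for j e m
  proof -
    have "mps_map (\<lambda>p. coeff p m) Qs = q m"
      by (rule mps_ext) (simp add: Qs)
    then have "mps_map (\<lambda>p. coeff p m) (U j) = mps_deriv j (q m)"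
      by (simp add: U_def mps_map_deriv)
    then show ?thesis
      by (metis mps_nth_map)
  qed
  have F: "mps_ord_ge (F j) 1" for j
    using P[of j] mps_ord_ge_X[of j] by (auto simp: F_def mps_ord_ge_def)
  \<comment> \<open>At \<open>s ^ m\<close> this is the recurrence \<open>q_Suc\<close>:
    \<open>poly_diff\<close> supplies the factor \<open>Suc m\<close>, and the factor 2 is written
    as a sum.\<close>
  have "mps_map poly_diff Qs + mps_map poly_diff Qs = (\<Sum>j\<in>UNIV. U j * U j)"
  proof (rule mps_ext, rule poly_eqI)
    fix e m
    have "coeff (mps_nth (mps_map poly_diff Qs + mps_map poly_diff Qs) e) m
        = mps_nth (of_nat (2 * Suc m) * q (Suc m)) e"
      unfolding mps_scale_of_nat mps_nth_scale of_nat_mult_eq_qscale[symmetric]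
        mps_nth_add coeff_add mps_nth_map coeff_poly_diff Qs
      by (simp add: algebra_simps)
    also have "\<dots> = (\<Sum>k\<le>m. \<Sum>j\<in>UNIV. \<Sum>a\<le>e.
        mps_nth (mps_deriv j (q k)) a * mps_nth (mps_deriv j (q (m - k))) (e - a))"
      by (simp only: q_Suc mps_nth_sum mps_nth_mult)
    also have "\<dots> = (\<Sum>j\<in>UNIV. \<Sum>k\<le>m. \<Sum>a\<le>e.
        mps_nth (mps_deriv j (q k)) a * mps_nth (mps_deriv j (q (m - k))) (e - a))"
      by (rule sum.swap)
    also have "\<dots> = (\<Sum>j\<in>UNIV. \<Sum>a\<le>e. \<Sum>k\<le>m.
        mps_nth (mps_deriv j (q k)) a * mps_nth (mps_deriv j (q (m - k))) (e - a))"
      by (intro sum.cong refl sum.swap)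
    also have "\<dots> = coeff (mps_nth (\<Sum>j\<in>UNIV. U j * U j) e) m"
      by (simp add: mps_nth_sum mps_nth_mult coeff_sum coeff_mult coeff_U)
    finally show "coeff (mps_nth (mps_map poly_diff Qs + mps_map poly_diff Qs) e) m
        = coeff (mps_nth (\<Sum>j\<in>UNIV. U j * U j) e) m" .
  qed
  \<comment> \<open>Since \<open>U\<close> is a gradient, \<open>mps_deriv i (U j)\<close> equals
    \<open>mps_deriv j (U i)\<close>; this turns the derivatives of the squares into transport
    terms.\<close>
  then have double: "mps_deriv i (mps_map poly_diff Qs) + mps_deriv i (mps_map poly_diff Qs)
      = (\<Sum>j\<in>UNIV. U j * mps_deriv j (U i)) + (\<Sum>j\<in>UNIV. U j * mps_deriv j (U i))" for i
    unfolding mps_deriv_add[symmetric]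
    by (simp add: mps_deriv_sum mps_deriv_mult U_def mps_deriv_commute[of i] mult.commute sum.distrib
        sum_distrib_left)
  have double_cancel: "f = g" if "f + f = g + g" for f g :: "('a poly, 'n) mps"
  proof (rule mps_ext, rule poly_eqI)
    fix e n
    have "coeff (mps_nth (f + f) e) n = coeff (mps_nth (g + g) e) n" by (simp only: that)
    then have "coeff (mps_nth f e) n + coeff (mps_nth f e) n = coeff (mps_nth g e) n + coeff (mps_nth g e) n"
      by (simp only: mps_nth_add coeff_add)
    then have "of_nat (Suc 1) * coeff (mps_nth f e) n = of_nat (Suc 1) * coeff (mps_nth g e) n"
      by (simp only: of_nat_Suc of_nat_1 distrib_right mult_1)
    then show "coeff (mps_nth f e) n = coeff (mps_nth g e) n"
      by (rule of_nat_Suc_mult_cancel)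
  qed
  have burgers: "mps_map poly_diff (U i) = (\<Sum>j\<in>UNIV. U j * mps_deriv j (U i))" for i
    using double_cancel[OF double] mps_map_deriv[of poly_diff i Qs] by (simp add: U_def)
  \<comment> \<open>By the Burgers equation the explicit dependence on \<open>s\<close> contributes
    \<open>U j\<close>, evaluated along \<open>F\<close>, times \<open>A i j\<close>; the motion of
    \<open>F\<close> subtracts \<open>mps_deriv j P\<close> times \<open>A i j\<close>. The
    difference of the two factors is \<open>W j\<close>.\<close>
  have W_diff: "mps_map poly_diff (W i) = (\<Sum>j\<in>UNIV. W j * A i j)" for i
  proof -
    have const: "mps_map poly_diff (mps_map (\<lambda>x. [:x:]) f) = 0" for f :: "('a, 'n) mps"
      by (rule mps_ext, rule poly_eqI) (simp add: coeff_poly_diff coeff_pCons)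
    have lin: "mps_map poly_diff (mps_map (\<lambda>x. monom x 1) f) = mps_map (\<lambda>x. [:x:]) f" for f :: "('a, 'n) mps"
      by (rule mps_ext, rule poly_eqI) (simp add: coeff_poly_diff coeff_pCons split: nat.split)
    have diff: "mps_map poly_diff (f - g) = mps_map poly_diff f - mps_map poly_diff g" for f g :: "('a poly, 'n) mps"
      by (rule mps_ext) simp
    have F': "mps_map poly_diff (F j) = - mps_map (\<lambda>x. [:x:]) (mps_deriv j P)" for j
      by (simp only: F_def diff lin poly_diff.mps_map_X diff_0)
    have "mps_map poly_diff (W i) = mps_compose (mps_map poly_diff (U i)) F +
        (\<Sum>j\<in>UNIV. A i j * mps_map poly_diff (F j))"
      unfolding W_def diff const A_def poly_diff.mps_map_compose[OF F] by simp
    also have "\<dots> = (\<Sum>j\<in>UNIV. mps_compose (U j) F * A i j + A i j * mps_map poly_diff (F j))"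
      by (simp add: burgers mps_compose_sum mps_compose_mult[OF F] A_def sum.distrib)
    also have "\<dots> = (\<Sum>j\<in>UNIV. W j * A i j)"
      by (simp add: F' W_def algebra_simps)
    finally show ?thesis .
  qed
  have W_0: "mps_map (\<lambda>p. coeff p 0) (W i) = 0" for i
  proof -
    have "mps_map (\<lambda>p. coeff p 0) (F j) = mps_X j" for j
      by (rule mps_ext) (simp add: F_def mps_nth_X)
    moreover have "mps_map (\<lambda>p. coeff p 0) (U i) = mps_deriv i P"
      by (rule mps_ext) (simp add: coeff_U q0)
    moreover have "mps_map (\<lambda>p. coeff p 0) (mps_map (\<lambda>x. [:x:]) (mps_deriv i P)) = mps_deriv i P"
      by (rule mps_ext) simp
    ultimately show ?thesis
      by (simp add: W_def coeff_0.mps_map_diff coeff_0.mps_map_compose mps_compose_X_right)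
  qed
  \<comment> \<open>The linear equation expresses \<open>Suc m\<close> times the coefficient at
    \<open>s ^ Suc m\<close> through coefficients up to \<open>s ^ m\<close>, so a zero initial
    value forces all of them to vanish.\<close>
  have "coeff (mps_nth (W i) e) k = 0" for i e k
  proof (induction k arbitrary: i e rule: less_induct)
    case (less k)
    show ?case
    proof (cases k)
      case 0
      then show ?thesis using W_0[of i] by (simp add: mps_eq_iff)
    next
      case (Suc m)
      have "of_nat (Suc m) * coeff (mps_nth (W i) e) (Suc m) = coeff (mps_nth (mps_map poly_diff (W i)) e) m"
        by (simp add: coeff_poly_diff)
      also have "\<dots> = (\<Sum>j\<in>UNIV. \<Sum>a\<le>e. \<Sum>l\<le>m. coeff (mps_nth (W j) a) l * coeff (mps_nth (A i j) (e - a)) (m - l))"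
        by (simp add: W_diff mps_nth_sum mps_nth_mult coeff_sum coeff_mult)
      also have "\<dots> = 0"
        using Suc by (simp add: less)
      finally show ?thesis
        using of_nat_Suc_mult_cancel[of m _ 0] Suc by simp
    qed
  qed
  then have "W i = 0"
    by (auto intro!: mps_ext poly_eqI)
  then have "0 = mps_map (\<lambda>p. poly p 1) (W i)"
    by (simp add: mps_eq_iff)
  also have "\<dots> = mps_compose (mps_map (\<lambda>p. poly p 1) (U i)) (\<lambda>i. mps_map (\<lambda>p. poly p 1) (F i))
      - mps_map (\<lambda>p. poly p 1) (mps_map (\<lambda>x. [:x:]) (mps_deriv i P))"
    by (simp add: W_def poly_at_1.mps_map_diff poly_at_1.mps_map_compose)
  also have "mps_map (\<lambda>p. poly p 1) (U i) = mps_deriv i Q"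
    by (simp add: U_def mps_map_deriv Q_eq)
  also have "(\<lambda>i. mps_map (\<lambda>p. poly p 1) (F i)) = (\<lambda>i. mps_X i - mps_deriv i P)"
    by (rule ext, rule mps_ext) (simp add: F_def mps_nth_X poly_monom)
  also have "mps_map (\<lambda>p. poly p 1) (mps_map (\<lambda>x. [:x:]) (mps_deriv i P)) = mps_deriv i P"
    by (rule mps_ext) simp
  finally show ?thesis by simp
qed

end

section \<open>From labelled trees to isomorphism classes\<close>

context rat_algebra
begin

text \<open>The exponential coefficient of \<open>labelled_series\<close>, indexed by the number of edges.\<close>

definition tree_sum :: "('a, 'n::finite) mps \<Rightarrow> nat \<Rightarrow> ('a, 'n) mps" where
  "tree_sum P m = mps_scale qscale (1 / fact (Suc m)) (labelled_series {..<Suc m} P)"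

text \<open>Grouping subsets by size gives a binomial convolution, and the division by
  \<open>fact (m + 2)\<close> splits each binomial coefficient into the two normalisations. The
  index counts edges: a tree with \<open>m + 1\<close> edges loses one and falls into parts with
  \<open>k\<close> and \<open>m - k\<close> edges.\<close>

lemma tree_sum_rec:
  "of_nat (2 * Suc m) * tree_sum P (Suc m) =
    (\<Sum>k\<le>m. \<Sum>j\<in>UNIV. mps_deriv j (tree_sum P k) * mps_deriv j (tree_sum P (m - k)))"
proof -
  let ?N = "Suc (Suc m)"
  let ?V = "{..<?N}"
  define L where "L n = labelled_series {..<n} P" for n :: nat
  define g where "g k = (\<Sum>j\<in>UNIV. mps_deriv j (L k) * mps_deriv j (L (?N - k)))" for k
  have L: "labelled_series S P = L (card S)" if "finite S" for S :: "nat set"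
    unfolding L_def using that by (intro labelled_series_card) simp_all
  have L0: "mps_deriv j (L 0) = 0" for j
    by (simp add: L_def mps_eq_iff mps_nth_deriv)
  have "of_nat (2 * Suc m) * L ?N =
      (\<Sum>S\<in>Pow ?V. \<Sum>j\<in>UNIV. mps_deriv j (labelled_series S P) * mps_deriv j (labelled_series (?V - S) P))"
    using labelled_series_rec[of ?V P] by (simp add: L_def)
  also have "\<dots> = (\<Sum>S\<in>Pow ?V. g (card S))"
  proof (rule sum.cong)
    fix S assume "S \<in> Pow ?V"
    then have "finite S" "S \<subseteq> ?V" by (auto intro: finite_subset)
    then show "(\<Sum>j\<in>UNIV. mps_deriv j (labelled_series S P) * mps_deriv j (labelled_series (?V - S) P)) = g (card S)"
      by (simp add: g_def L card_Diff_subset)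
  qed simp
  also have "\<dots> = (\<Sum>k\<le>?N. \<Sum>S\<in>{S \<in> Pow ?V. card S = k}. g (card S))"
  proof (rule sum.group[symmetric])
    show "card ` Pow ?V \<subseteq> {..?N}"
      using card_mono[of ?V] by (auto simp del: lessThan_Suc)
  qed simp_all
  also have "\<dots> = (\<Sum>k\<le>?N. of_nat (?N choose k) * g k)"
    using n_subsets[of ?V] by (intro sum.cong) simp_all
  \<comment> \<open>The extreme sizes drop out because there is no tree on the empty set.\<close>
  also have "\<dots> = (\<Sum>k\<in>{1..Suc m}. of_nat (?N choose k) * g k)"
  proof (rule sum.mono_neutral_right)
    show "\<forall>k\<in>{..?N} - {1..Suc m}. of_nat (?N choose k) * g k = 0"
    proof
      fix k assume "k \<in> {..?N} - {1..Suc m}"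
      then have "k = 0 \<or> k = ?N" by auto
      then show "of_nat (?N choose k) * g k = 0" by (auto simp: g_def L0)
    qed
  qed auto
  also have "\<dots> = (\<Sum>k\<le>m. of_nat (?N choose Suc k) * g (Suc k))"
    by (rule sum.reindex_bij_witness[where i = Suc and j = "\<lambda>k. k - 1"]) auto
  finally have rec: "of_nat (2 * Suc m) * L ?N = (\<Sum>k\<le>m. of_nat (?N choose Suc k) * g (Suc k))" .
  have "of_nat (2 * Suc m) * tree_sum P (Suc m) = mps_scale qscale (1 / fact ?N) (of_nat (2 * Suc m) * L ?N)"
    unfolding mps_scale_of_nat tree_sum_def L_def mps_scale_scale by (simp add: mult.commute)
  also have "\<dots> = (\<Sum>k\<le>m. mps_scale qscale (1 / fact ?N * of_nat (?N choose Suc k)) (g (Suc k)))"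
    unfolding rec mps_scale_sum unfolding mps_scale_of_nat mps_scale_scale ..
  also have "\<dots> = (\<Sum>k\<le>m. \<Sum>j\<in>UNIV. mps_deriv j (tree_sum P k) * mps_deriv j (tree_sum P (m - k)))"
  proof (rule sum.cong)
    fix k assume "k \<in> {..m}"
    then have k: "k \<le> m" by simp
    then have "1 / fact ?N * of_nat (?N choose Suc k) = 1 / fact (Suc k) * (1 / fact (Suc (m - k)) :: rat)"
      by (subst binomial_fact) (auto simp: Suc_diff_le simp del: fact_Suc)
    moreover have "?N - Suc k = Suc (m - k)" using k by simp
    ultimately show "mps_scale qscale (1 / fact ?N * of_nat (?N choose Suc k)) (g (Suc k)) =
        (\<Sum>j\<in>UNIV. mps_deriv j (tree_sum P k) * mps_deriv j (tree_sum P (m - k)))"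
      by (simp only: g_def mps_scale_sum tree_sum_def L_def mps_scale_deriv[symmetric] mps_scale_mult)
  qed simp
  finally show ?thesis .
qed

end

section \<open>Isomorphism classes and their labelled representatives\<close>

definition tree_size :: "nat graph set \<Rightarrow> nat" where
  "tree_size C = card (verts (tree_rep C))"

definition tree_class :: "nat graph \<Rightarrow> nat graph set" where
  "tree_class T = tree_iso_rel `` {T}"

lemma tree_rep_in:
  assumes "C \<in> free_trees"
  shows "tree_rep C \<in> C"
proof -
  have "C \<noteq> {}"
    using assms in_quotient_imp_non_empty[OF equiv_tree_iso_rel] by (auto simp: free_trees_def)
  then show ?thesis
    by (simp add: tree_rep_def some_in_eq)
qed

lemma is_tree_rep: "C \<in> free_trees \<Longrightarrow> is_tree (tree_rep C)"
  using tree_rep_in in_quotient_imp_subset[OF equiv_tree_iso_rel] by (auto simp: free_trees_def)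

lemma tree_class_in: "is_tree T \<Longrightarrow> tree_class T \<in> free_trees"
  by (simp add: tree_class_def free_trees_def quotientI)

lemma tree_class_eq_iff:
  assumes "C \<in> free_trees" "is_tree T"
  shows "tree_class T = C \<longleftrightarrow> graph_iso (tree_rep C) T"
proof -
  obtain T' where T': "is_tree T'" "C = tree_class T'"
    using assms(1) by (auto simp: free_trees_def tree_class_def elim: quotientE)
  have "tree_class (tree_rep C) = C"
    using equiv_class_eq[OF equiv_tree_iso_rel, of T' "tree_rep C"] tree_rep_in[OF assms(1)] T'(2)
    by (simp add: tree_class_def)
  then have "tree_class T = C \<longleftrightarrow> (tree_rep C, T) \<in> tree_iso_rel"
    using eq_equiv_class_iff[OF equiv_tree_iso_rel, of "tree_rep C" T] is_tree_rep[OF assms(1)] assms(2)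
    by (auto simp: tree_class_def)
  then show ?thesis
    using is_tree_rep[OF assms(1)] assms(2) by (simp add: tree_iso_rel_def)
qed

lemma graph_iso_image: "inj_on f V \<Longrightarrow> graph_iso (V, E) (f ` V, (`) f ` E)"
  unfolding graph_iso_def by (intro exI[of _ f]) (simp add: bij_betw_def)

lemma graph_iso_card: "graph_iso T T' \<Longrightarrow> card (verts T) = card (verts T')"
  by (auto simp: graph_iso_def intro: bij_betw_same_card)

lemma image_comp_image: "(`) (f \<circ> g) ` E = (`) f ` (`) g ` E"
  by (simp add: image_image image_comp)

lemma graph_aut_iff: "q \<in> graph_aut (V, E) \<longleftrightarrow> q permutes V \<and> (`) q ` E = E"
  by (simp add: graph_aut_def)

text \<open>Permutations of \<open>V\<close> act on edge sets, and \<open>graph_aut\<close> is the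
  stabiliser of \<open>E\<close>. The permutations that send \<open>E\<close> to the same image as
  \<open>p\<close> form the coset of \<open>p\<close>, so all fibres of the orbit map have the same
  size.\<close>

lemma card_orbit_mult_card_aut:
  assumes V: "finite V"
  shows "card ((\<lambda>p. (`) p ` E) ` {p. p permutes V}) * card (graph_aut (V, E)) = fact (card V)"
proof -
  let ?S = "{p. p permutes V}"
  let ?\<phi> = "\<lambda>p. (`) p ` E"
  have fin: "finite ?S" using V by (rule finite_permutations)
  have fibre: "card {q \<in> ?S. ?\<phi> q = ?\<phi> p} = card (graph_aut (V, E))" if p: "p permutes V" for p
  proof -
    have "bij_betw (\<lambda>q. p \<circ> q) (graph_aut (V, E)) {q \<in> ?S. ?\<phi> q = ?\<phi> p}"
    proof (rule bij_betw_byWitness[where f' = "\<lambda>q. inv p \<circ> q"])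
      show "\<forall>q\<in>graph_aut (V, E). inv p \<circ> (p \<circ> q) = q"
        using permutes_inv_o(2)[OF p] by (simp add: o_assoc)
      show "\<forall>q\<in>{q \<in> ?S. ?\<phi> q = ?\<phi> p}. p \<circ> (inv p \<circ> q) = q"
        using permutes_inv_o(1)[OF p] by (simp add: o_assoc)
      show "(\<lambda>q. p \<circ> q) ` graph_aut (V, E) \<subseteq> {q \<in> ?S. ?\<phi> q = ?\<phi> p}"
      proof
        fix r assume "r \<in> (\<lambda>q. p \<circ> q) ` graph_aut (V, E)"
        then obtain q where q: "q permutes V" "(`) q ` E = E" "r = p \<circ> q"
          by (auto simp: graph_aut_iff)
        have "?\<phi> r = ?\<phi> p" by (simp only: q image_comp_image)
        then show "r \<in> {q \<in> ?S. ?\<phi> q = ?\<phi> p}"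
          using permutes_compose[OF q(1) p] q(3) by simp
      qed
      show "(\<lambda>q. inv p \<circ> q) ` {q \<in> ?S. ?\<phi> q = ?\<phi> p} \<subseteq> graph_aut (V, E)"
      proof
        fix r assume "r \<in> (\<lambda>q. inv p \<circ> q) ` {q \<in> ?S. ?\<phi> q = ?\<phi> p}"
        then obtain q where q: "q permutes V" "?\<phi> q = ?\<phi> p" "r = inv p \<circ> q" by auto
        have "?\<phi> r = ?\<phi> (inv p \<circ> p)" by (simp only: q image_comp_image)
        also have "\<dots> = E" by (simp add: permutes_inv_o(2)[OF p])
        finally show "r \<in> graph_aut (V, E)"
          using permutes_compose[OF q(1) permutes_inv[OF p]] q(3) by (simp add: graph_aut_iff)
      qed
    qed
    then show ?thesis by (simp add: bij_betw_same_card)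
  qed
  have "fact (card V) = card ?S" using V by (simp add: card_permutations)
  also have "\<dots> = (\<Sum>Y\<in>?\<phi> ` ?S. card {q \<in> ?S. ?\<phi> q = Y})"
    using sum.group[OF fin finite_imageI[OF fin], of ?\<phi> ?\<phi> "\<lambda>_. 1 :: nat"] by simp
  also have "\<dots> = (\<Sum>Y\<in>?\<phi> ` ?S. card (graph_aut (V, E)))"
    by (rule sum.cong) (use fibre in auto)
  finally show ?thesis by simp
qed

text \<open>With one bijection \<open>f\<close> from \<open>V\<close> to \<open>W\<close> fixed,
  every isomorphism factors into a permutation of \<open>V\<close> followed by \<open>f\<close>, so
  the labellings are the orbit of \<open>E\<close> carried over by \<open>f\<close>.\<close>

lemma card_labellings_mult_card_aut:
  assumes E: "E \<in> trees_on V" and W: "finite W" "card W = card V"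
  shows "card {D \<in> trees_on W. graph_iso (V, E) (W, D)} * card (graph_aut (V, E)) = fact (card W)"
proof -
  note V = trees_on_finite[OF E]
  obtain f where f: "bij_betw f V W" using finite_same_card_bij[OF V W(1)] W(2) by auto
  then have inj: "inj_on f V" and im: "f ` V = W" by (auto simp: bij_betw_def)
  let ?O = "(\<lambda>p. (`) p ` E) ` {p. p permutes V}"
  have sub: "E \<subseteq> Pow V" using trees_on_edge_subset[OF E] by blast
  have "{D \<in> trees_on W. graph_iso (V, E) (W, D)} = (`) ((`) f) ` ?O"
  proof (intro equalityI subsetI)
    fix D assume "D \<in> {D \<in> trees_on W. graph_iso (V, E) (W, D)}"
    then obtain h where h: "bij_betw h V W" "(`) h ` E = D" by (auto simp: graph_iso_def)
    \<comment> \<open>The identity outside \<open>V\<close> is what \<open>permutes\<close>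
      requires.\<close>
    define p where "p x = (if x \<in> V then inv_into V f (h x) else x)" for x
    have "bij_betw p V V"
      using bij_betw_trans[OF h(1) bij_betw_inv_into[OF f]]
      by (rule bij_betw_cong[THEN iffD1, rotated]) (simp add: p_def)
    then have "p permutes V" by (rule bij_imp_permutes) (simp add: p_def)
    moreover have "f ` p ` e = h ` e" if "e \<in> E" for e
    proof -
      have "f (p x) = h x" if "x \<in> V" for x
        using that f h(1) by (simp add: p_def bij_betw_inv_into_right bij_betwE)
      then show ?thesis using sub that by (force simp: image_image)
    qed
    then have "(`) f ` (`) p ` E = D"
      unfolding h(2)[symmetric] image_image[of "(`) f"] by (rule image_cong[OF refl])
    ultimately show "D \<in> (`) ((`) f) ` ?O" by blast
  next
    fix D assume "D \<in> (`) ((`) f) ` ?O"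
    then obtain p where p: "p permutes V" "D = (`) f ` (`) p ` E" by auto
    have "inj_on (f \<circ> p) V"
      using inj permutes_image[OF p(1)] permutes_inj_on[OF p(1)] by (intro comp_inj_on) simp_all
    moreover have "(f \<circ> p) ` V = W"
      using im permutes_image[OF p(1)] by (simp only: image_comp[symmetric])
    ultimately show "D \<in> {D \<in> trees_on W. graph_iso (V, E) (W, D)}"
      using trees_on_image[OF E, of "f \<circ> p"] graph_iso_image[of "f \<circ> p" V E]
      by (simp only: p(2) image_comp_image mem_Collect_eq simp_thms)
  qed
  moreover have "inj_on ((`) ((`) f)) ?O"
  proof (rule inj_on_subset[OF inj_on_image_Pow[OF inj_on_image_Pow[OF inj]]])
    show "?O \<subseteq> Pow (Pow V)"
    proof clarify
      fix p e x assume "p permutes V" "e \<in> E" "x \<in> e"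
      then show "p x \<in> V" using sub permutes_in_image by fastforce
    qed
  qed
  ultimately show ?thesis
    using card_orbit_mult_card_aut[OF V, of E] W(2) by (simp add: card_image)
qed

lemma graph_iso_tree_series:
  assumes "E \<in> trees_on V" "graph_iso (V, E) (W, D)"
  shows "tree_series (W, D) P = tree_series (V, E) P"
proof -
  obtain f where f: "bij_betw f V W" "(`) f ` E = D" using assms(2) by (auto simp: graph_iso_def)
  then have "inj_on f V" "f ` V = W" by (auto simp: bij_betw_def)
  then show ?thesis using tree_series_image[OF assms(1), of f P] f(2) by simp
qed

text \<open>Every class has a member on the initial segment of its size. This yields finiteness of
  the classes of given size and lets labelled trees be grouped by class.\<close>

lemma free_trees_of_size_eq:
  "{C \<in> free_trees. tree_size C = n} = (\<lambda>E. tree_class ({..<n}, E)) ` trees_on {..<n}"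
proof (intro equalityI subsetI)
  fix C assume "C \<in> {C \<in> free_trees. tree_size C = n}"
  then have C: "C \<in> free_trees" "tree_size C = n" by auto
  obtain V E where T: "tree_rep C = (V, E)" by force
  have E: "E \<in> trees_on V" using is_tree_rep[OF C(1)] T by (simp add: trees_on_def)
  have "card V = card {..<n}" using C(2) T by (simp add: tree_size_def)
  then obtain f where "bij_betw f V {..<n}"
    using finite_same_card_bij[OF trees_on_finite[OF E]] by blast
  then have f: "inj_on f V" "f ` V = {..<n}" by (auto simp: bij_betw_def)
  have D: "(`) f ` E \<in> trees_on {..<n}" using trees_on_image[OF E f(1)] f(2) by simp
  have "graph_iso (tree_rep C) ({..<n}, (`) f ` E)"
    using graph_iso_image[OF f(1), of E] f(2) T by simp
  then have "tree_class ({..<n}, (`) f ` E) = C"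
    using tree_class_eq_iff[OF C(1)] D by (simp add: trees_on_def)
  then show "C \<in> (\<lambda>E. tree_class ({..<n}, E)) ` trees_on {..<n}" using D by blast
next
  fix C assume "C \<in> (\<lambda>E. tree_class ({..<n}, E)) ` trees_on {..<n}"
  then obtain E where E: "is_tree ({..<n}, E)" "C = tree_class ({..<n}, E)"
    by (auto simp: trees_on_def)
  then have C: "C \<in> free_trees" by (simp add: tree_class_in)
  then have "graph_iso (tree_rep C) ({..<n}, E)" using E tree_class_eq_iff by blast
  then show "C \<in> {C \<in> free_trees. tree_size C = n}"
    using C graph_iso_card by (fastforce simp: tree_size_def)
qed

lemma tree_size_pos:
  assumes "C \<in> free_trees"
  shows "0 < tree_size C"
proof -
  obtain V E where T: "tree_rep C = (V, E)" by force
  then have "E \<in> trees_on V" using is_tree_rep[OF assms] by (simp add: trees_on_def)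
  then show ?thesis using T by (auto simp: tree_size_def trees_on_iff card_gt_0_iff)
qed

section \<open>Regrouping by isomorphism class, and convergence\<close>

context rat_algebra
begin

text \<open>Labelled trees in one class share their series, and there are \<open>n! / |Aut|\<close>
  of them; the weight \<open>1 / n!\<close> thus becomes \<open>1 / |Aut|\<close>.\<close>

lemma sum_tree_term_of_size:
  "(\<Sum>C | C \<in> free_trees \<and> tree_size C = Suc m. tree_term qscale P (tree_rep C)) = tree_sum P m"
proof -
  let ?n = "Suc m"
  let ?V = "{..<?n}"
  let ?F = "{C \<in> free_trees. tree_size C = ?n}"
  let ?cl = "\<lambda>E. tree_class (?V, E)"
  have fin: "finite (trees_on ?V)" by (rule finite_trees_on) simp
  have "tree_sum P m = mps_scale qscale (1 / fact ?n) (\<Sum>C\<in>?F. \<Sum>E\<in>{E \<in> trees_on ?V. ?cl E = C}. tree_series (?V, E) P)"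
    unfolding tree_sum_def labelled_series_def free_trees_of_size_eq
    by (subst sum.group[OF fin finite_imageI[OF fin]]) simp_all
  also have "\<dots> = (\<Sum>C\<in>?F. tree_term qscale P (tree_rep C))"
    unfolding mps_scale_sum[of _ _ ?F]
  proof (rule sum.cong)
    fix C assume "C \<in> ?F"
    then have C: "C \<in> free_trees" "tree_size C = ?n" by auto
    obtain V E where T: "tree_rep C = (V, E)" by force
    have E: "E \<in> trees_on V" using is_tree_rep[OF C(1)] T by (simp add: trees_on_def)
    have card: "card V = ?n" using C(2) T by (simp add: tree_size_def)
    have K: "{D \<in> trees_on ?V. ?cl D = C} = {D \<in> trees_on ?V. graph_iso (V, E) (?V, D)}"
      using tree_class_eq_iff[OF C(1)] T by (auto simp: trees_on_def)
    have "(\<Sum>D\<in>{D \<in> trees_on ?V. ?cl D = C}. tree_series (?V, D) P) =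
        (\<Sum>D\<in>{D \<in> trees_on ?V. ?cl D = C}. tree_series (V, E) P)"
      unfolding K by (rule sum.cong) (auto intro: graph_iso_tree_series[OF E])
    also have "\<dots> = of_nat (card {D \<in> trees_on ?V. ?cl D = C}) * tree_series (V, E) P"
      by simp
    finally have "mps_scale qscale (1 / fact ?n) (\<Sum>D\<in>{D \<in> trees_on ?V. ?cl D = C}. tree_series (?V, D) P) =
        mps_scale qscale (1 / fact ?n * of_nat (card {D \<in> trees_on ?V. ?cl D = C})) (tree_series (V, E) P)"
      by (simp only: mps_scale_of_nat mps_scale_scale)
    also have "1 / fact ?n * of_nat (card {D \<in> trees_on ?V. ?cl D = C}) = (1 / of_nat (card (graph_aut (V, E))) :: rat)"
    proof -
      have "card {D \<in> trees_on ?V. ?cl D = C} * card (graph_aut (V, E)) = fact ?n"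
        using card_labellings_mult_card_aut[OF E, of ?V] card unfolding K by simp
      then have "of_nat (card {D \<in> trees_on ?V. ?cl D = C} * card (graph_aut (V, E))) = (of_nat (fact ?n) :: rat)"
        by (rule arg_cong)
      then have k: "of_nat (card {D \<in> trees_on ?V. ?cl D = C}) * of_nat (card (graph_aut (V, E))) = (fact ?n :: rat)"
        by (simp only: of_nat_mult of_nat_fact)
      have "1 / c * a = 1 / b" if "a * b = c" "c \<noteq> 0" for a b c :: rat
        using that by (auto simp: field_simps)
      from this[OF k fact_nonzero] show ?thesis .
    qed
    finally show "mps_scale qscale (1 / fact ?n) (\<Sum>D\<in>{D \<in> trees_on ?V. ?cl D = C}. tree_series (?V, D) P) =
        tree_term qscale P (tree_rep C)"
      by (simp add: tree_term_def T)
  qed simp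
  finally show ?thesis by simp
qed

text \<open>The bound is weaker than \<open>n + 2\<close> in order to include the single vertex,
  whose series \<open>P\<close> may have a constant term.\<close>

lemma mps_ord_ge_tree_term:
  assumes P: "\<And>i. mps_ord_ge (mps_deriv i P) 2" and C: "C \<in> free_trees"
  shows "mps_ord_ge (tree_term qscale P (tree_rep C)) (tree_size C - 1)"
proof (cases "tree_size C = 1")
  case False
  obtain V E where T: "tree_rep C = (V, E)" by force
  have E: "E \<in> trees_on V" using is_tree_rep[OF C] T by (simp add: trees_on_def)
  have "card V = tree_size C" using T by (simp add: tree_size_def)
  then have "mps_ord_ge (tree_series (V, E) P) (tree_size C - 1)"
    using mps_ord_ge_tree_series[OF P E] False tree_size_pos[OF C] by (auto intro: mps_ord_ge_mono)
  then show ?thesis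
    by (simp add: tree_term_def T mps_ord_ge_def mps_nth_scale)
qed simp

lemma mps_ord_ge_tree_sum:
  assumes P: "\<And>i. mps_ord_ge (mps_deriv i P) 2"
  shows "mps_ord_ge (tree_sum P m) m"
  unfolding sum_tree_term_of_size[symmetric]
proof (rule mps_ord_ge_sum)
  fix C assume "C \<in> {C. C \<in> free_trees \<and> tree_size C = Suc m}"
  then show "mps_ord_ge (tree_term qscale P (tree_rep C)) m"
    using mps_ord_ge_tree_term[OF P, of C] by simp
qed

lemma tree_sum_0: "tree_sum P 0 = P"
proof -
  have "tree_series ({0}, {}) P = P"
    by (simp add: tree_series_def adj_def)
  moreover have "{..<Suc 0} = {0}" by auto
  ultimately show ?thesis
    by (simp add: tree_sum_def labelled_series_def trees_on_singleton mps_eq_iff mps_nth_scale)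
qed

text \<open>In degrees below \<open>N\<close> only trees with at most \<open>N\<close> vertices
  contribute. There are finitely many such classes, and every finite sum that includes them agrees
  with \<open>Q\<close> in these degrees.\<close>

lemma has_sum_tree_term:
  assumes P: "\<And>i. mps_ord_ge (mps_deriv i P) 2"
  defines "Q \<equiv> Abs_mps (\<lambda>e. \<Sum>m\<le>mdeg e. mps_nth (tree_sum P m) e)"
  shows "((\<lambda>C. tree_term qscale P (tree_rep C)) has_sum Q) free_trees"
  unfolding has_sum_def
proof (rule topological_tendstoI)
  let ?t = "\<lambda>C. tree_term qscale P (tree_rep C)"
  let ?B = "\<lambda>n. {C \<in> free_trees. tree_size C \<le> n}"
  fix U assume "open U" "Q \<in> U"
  then obtain N where N: "\<And>g. (\<And>e. mdeg e < N \<Longrightarrow> mps_nth g e = mps_nth Q e) \<Longrightarrow> g \<in> U"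
    unfolding open_mps_def by blast
  have B_eq: "?B n = (\<Union>k\<le>n. {C \<in> free_trees. tree_size C = k})" for n by auto
  have fin: "finite (?B n)" for n
    unfolding B_eq free_trees_of_size_eq by (auto intro: finite_trees_on)
  have Q: "mps_nth Q e = (\<Sum>C\<in>?B (Suc (mdeg e)). mps_nth (?t C) e)" for e
  proof -
    have "mps_nth Q e = (\<Sum>m\<le>mdeg e. \<Sum>C | C \<in> ?B (Suc (mdeg e)) \<and> tree_size C - 1 = m. mps_nth (?t C) e)"
      unfolding Q_def mps_nth_Abs_mps sum_tree_term_of_size[symmetric] mps_nth_sum
    proof (intro sum.cong refl)
      fix m assume m: "m \<in> {..mdeg e}"
      \<comment> \<open>A tree has at least one vertex, so the truncated subtraction is exact and a
        single vertex is the only case for \<open>m = 0\<close>.\<close>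
      have "tree_size C = Suc m \<longleftrightarrow> tree_size C \<le> Suc (mdeg e) \<and> tree_size C - 1 = m"
        if "C \<in> free_trees" for C
        using m tree_size_pos[OF that] by auto
      then show "{C. C \<in> free_trees \<and> tree_size C = Suc m} = {C. C \<in> ?B (Suc (mdeg e)) \<and> tree_size C - 1 = m}"
        by auto
    qed
    also have "\<dots> = (\<Sum>C\<in>?B (Suc (mdeg e)). mps_nth (?t C) e)"
      by (rule sum.group[OF fin]) auto
    finally show ?thesis .
  qed
  show "\<forall>\<^sub>F A in finite_subsets_at_top free_trees. sum ?t A \<in> U"
    unfolding eventually_finite_subsets_at_top
  proof (intro exI[of _ "?B N"] conjI allI impI fin)
    fix A assume A: "finite A \<and> ?B N \<subseteq> A \<and> A \<subseteq> free_trees"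
    show "sum ?t A \<in> U"
    proof (rule N)
      fix e :: "'b \<Rightarrow> nat" assume e: "mdeg e < N"
      have "mps_nth (sum ?t A) e = (\<Sum>C\<in>?B (Suc (mdeg e)). mps_nth (?t C) e)"
        unfolding mps_nth_sum
      proof (rule sum.mono_neutral_right)
        show "finite A" using A by simp
        show "?B (Suc (mdeg e)) \<subseteq> A" using A e by auto
        show "\<forall>C\<in>A - ?B (Suc (mdeg e)). mps_nth (?t C) e = 0"
        proof
          fix C assume "C \<in> A - ?B (Suc (mdeg e))"
          then have "C \<in> free_trees" "mdeg e < tree_size C - 1" using A by auto
          then show "mps_nth (?t C) e = 0"
            using mps_ord_geD[OF mps_ord_ge_tree_term[OF P]] by blast
        qed
      qed
      then show "mps_nth (sum ?t A) e = mps_nth Q e" by (simp only: Q)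
    qed
  qed auto
qed

end

theorem theorem2p3:
  fixes qscale :: "rat \<Rightarrow> 'a::comm_ring_1 \<Rightarrow> 'a"
    and P :: "('a, 'n::finite) mps"
    and F G :: "'n \<Rightarrow> ('a, 'n) mps"
  assumes "rat_algebra qscale"
    and "\<And>i e. mdeg e < 2 \<Longrightarrow> mps_nth (mps_deriv i P) e = 0"
    and "F = (\<lambda>i. mps_X i - mps_deriv i P)"
    and "formal_inverse F G"
  shows "\<exists>Q. ((\<lambda>C. tree_term qscale P (tree_rep C)) has_sum Q) free_trees \<and>
             G = (\<lambda>i. mps_X i + mps_deriv i Q)"
proof -
  interpret rat_algebra qscale by (rule assms(1))
  have P: "mps_ord_ge (mps_deriv i P) 2" for i
    using assms(2) by (simp add: mps_ord_ge_def)
  have F: "special_type F"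
    using assms(2) by (simp add: special_type_def assms(3))
  define Q where "Q = Abs_mps (\<lambda>e. \<Sum>m\<le>mdeg e. mps_nth (tree_sum P m) e)"
  have "mps_compose (mps_deriv i Q) F = mps_deriv i P" for i
    unfolding Q_def assms(3)
    by (rule compose_gradient_of_burgers_solution[OF P tree_sum_0 tree_sum_rec mps_ord_ge_tree_sum[OF P]])
  then have inverse: "mps_compose (mps_X i + mps_deriv i Q) F = mps_X i" for i
    using mps_compose_X_left[OF special_type_ord_ge(1)[OF F], of i]
    by (simp add: mps_compose_add assms(3))
  have "G i = mps_X i + mps_deriv i Q" for i
    by (rule mps_compose_special_inject[OF F]) (use assms(4) inverse in \<open>simp add: formal_inverse_def\<close>)
  then show ?thesis
    using has_sum_tree_term[OF P] unfolding Q_def by blast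
qed

end
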